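(* Let $d\ge1$, let $\kappa\in\mathbb{R}^{d+1}$ with $\kappa_j>-1$ for all $j$, and let $N$ be a positive integer. The Poisson kernel $$\Phi_r(\mathsf{H}_{\kappa,N};x,y)=\sum_{n=0}^N\mathsf{P}_n(\mathsf{H}_{\kappa,N};x,y)\,r^n$$ of the Hahn polynomials is nonnegative for all $x,y\in\mathbb{Z}_N^{d+1}$ and $0\le r\le1$. Furthermore, for $r=1$ and all $x,y\in\mathbb{Z}_N^{d+1}$, $$\Phi_1(\mathsf{H}_{\kappa,N};x,y)=\frac{(|\kappa|+d+1)_N}{N!}\,\mathcal{E}_N(x,y;\kappa).$$
   Context: Notation: $(a)_k=a(a+1)\cdots(a+k-1)$; for vectors, $|\cdot|$ is the sum of the components, $\gamma!=\prod_i\gamma_i!$, $(-x)_\gamma=\prod_i(-x_i)_{\gamma_i}$, $\mathbf 1=(1,\ldots,1)$, $(\kappa+\mathbf 1)_\gamma=\prod_{i=1}^{d+1}(\kappa_i+1)_{\gamma_i}$. $\mathbb{Z}_N^{d+1}=\{\alpha\in\mathbb{N}_0^{d+1}:|\alpha|=N\}$. Hahn inner product of functions on $\mathbb{Z}_N^{d+1}$: $$\langle f,g\rangle_{\mathsf{H}_{\kappa,N}}=\frac{N!}{(|\kappa|+d+1)_N}\sum_{\alpha\in\mathbb{Z}_N^{d+1}}f(\alpha)g(\alpha)\frac{(\kappa+\mathbf 1)_\alpha}{\alpha!},$$ normalized so that $\langle1,1\rangle=1$. A polynomial on $\mathbb{Z}_N^{d+1}$ of degree at most $n$ is the restriction of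 a polynomial of total degree at most $n$ in the first $d$ coordinates. For $0\le n\le N$, $\mathcal{V}_n^d(\mathsf{H}_{\kappa,N})$ is the space of polynomials of degree at most $n$ on $\mathbb{Z}_N^{d+1}$ orthogonal to all polynomials of degree at most $n-1$. $\mathsf{P}_n(\mathsf{H}_{\kappa,N};x,y)$ is the reproducing kernel of $\mathcal{V}_n^d(\mathsf{H}_{\kappa,N})$: it lies in $\mathcal{V}_n^d(\mathsf{H}_{\kappa,N})$ in each variable and $\langle\mathsf{P}_n(\mathsf{H}_{\kappa,N};x,\cdot),Q\rangle_{\mathsf{H}_{\kappa,N}}=Q(x)$ for all $Q\in\mathcal{V}_n^d(\mathsf{H}_{\kappa,N})$. For $x,y\in\mathbb{Z}_N^{d+1}$, $$\mathcal{E}_N(x,y;\kappa)=\sum_{\gamma\in\mathbb{N}_0^{d+1},\,|\gamma|=N}\frac{(-x)_\gamma(-y)_\gamma}{(\kappa+\mathbf 1)_\gamma\,\gamma!}.$$ *)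

theory Defs
  imports "HOL-Analysis.Analysis"
begin

text \<open>
  Vectors in \<open>d + 1\<close> coordinates are functions on \<open>nat\<close>, with coordinate set
  \<open>{..d} = {0, \<dots>, d}\<close>; the ``first \<open>d\<close> coordinates'' are those in \<open>{..<d}\<close>.
  Integer vectors are required to vanish off the coordinate set, so that equality of
  vectors is equality of functions. Entries \<open>\<kappa> j\<close> with \<open>j > d\<close> are never used.
\<close>

definition lattice_simplex :: "nat \<Rightarrow> nat \<Rightarrow> (nat \<Rightarrow> nat) set" where
  "lattice_simplex d N = {\<alpha>. (\<forall>i>d. \<alpha> i = 0) \<and> (\<Sum>i\<le>d. \<alpha> i) = N}"

definition vec_pochhammer :: "nat \<Rightarrow> (nat \<Rightarrow> real) \<Rightarrow> (nat \<Rightarrow> nat) \<Rightarrow> real" where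
  "vec_pochhammer d a \<gamma> = (\<Prod>i\<le>d. pochhammer (a i) (\<gamma> i))"

definition vec_fact :: "nat \<Rightarrow> (nat \<Rightarrow> nat) \<Rightarrow> real" where
  "vec_fact d \<gamma> = (\<Prod>i\<le>d. fact (\<gamma> i))"

definition hahn_inner ::
  "nat \<Rightarrow> (nat \<Rightarrow> real) \<Rightarrow> nat \<Rightarrow> ((nat \<Rightarrow> nat) \<Rightarrow> real) \<Rightarrow> ((nat \<Rightarrow> nat) \<Rightarrow> real) \<Rightarrow> real" where
  "hahn_inner d \<kappa> N f g =
     fact N / pochhammer ((\<Sum>i\<le>d. \<kappa> i) + real d + 1) N *
     (\<Sum>\<alpha>\<in>lattice_simplex d N.
        f \<alpha> * g \<alpha> * vec_pochhammer d (\<lambda>i. \<kappa> i + 1) \<alpha> / vec_fact d \<alpha>)"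

definition exponents_le :: "nat \<Rightarrow> nat \<Rightarrow> (nat \<Rightarrow> nat) set" where
  "exponents_le d n = {\<gamma>. (\<forall>i\<ge>d. \<gamma> i = 0) \<and> (\<Sum>i<d. \<gamma> i) \<le> n}"

text \<open>
  A function on the lattice simplex is represented by any function that agrees with it
  there; the values elsewhere are unconstrained. Hence a polynomial is constrained only on
  the lattice simplex.
\<close>

definition hahn_polys :: "nat \<Rightarrow> nat \<Rightarrow> nat \<Rightarrow> ((nat \<Rightarrow> nat) \<Rightarrow> real) set" where
  "hahn_polys d N n =
     {f. \<exists>c. \<forall>x\<in>lattice_simplex d N.
           f x = (\<Sum>\<gamma>\<in>exponents_le d n. c \<gamma> * (\<Prod>i<d. real (x i) ^ \<gamma> i))}"

text \<open>
  ``Of degree at most \<open>n - 1\<close>'' is expressed by \<open>m < n\<close>, since truncated subtraction would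
  be wrong for \<open>n = 0\<close>, where there is no orthogonality condition.
\<close>

definition hahn_space ::
  "nat \<Rightarrow> (nat \<Rightarrow> real) \<Rightarrow> nat \<Rightarrow> nat \<Rightarrow> ((nat \<Rightarrow> nat) \<Rightarrow> real) set" where
  "hahn_space d \<kappa> N n =
     {f \<in> hahn_polys d N n. \<forall>m<n. \<forall>g\<in>hahn_polys d N m. hahn_inner d \<kappa> N f g = 0}"

definition is_hahn_kernel ::
  "nat \<Rightarrow> (nat \<Rightarrow> real) \<Rightarrow> nat \<Rightarrow> nat \<Rightarrow> ((nat \<Rightarrow> nat) \<Rightarrow> (nat \<Rightarrow> nat) \<Rightarrow> real) \<Rightarrow> bool" where
  "is_hahn_kernel d \<kappa> N n K \<longleftrightarrow>
     (\<forall>y\<in>lattice_simplex d N. (\<lambda>x. K x y) \<in> hahn_space d \<kappa> N n) \<and>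
     (\<forall>x\<in>lattice_simplex d N. (\<lambda>y. K x y) \<in> hahn_space d \<kappa> N n) \<and>
     (\<forall>x\<in>lattice_simplex d N. \<forall>Q\<in>hahn_space d \<kappa> N n. hahn_inner d \<kappa> N (K x) Q = Q x)"

text \<open>
  The defining properties determine the kernel only at pairs of points of the lattice
  simplex, so it is selected with \<open>SOME\<close> rather than \<open>THE\<close>.
\<close>

definition hahn_kernel ::
  "nat \<Rightarrow> (nat \<Rightarrow> real) \<Rightarrow> nat \<Rightarrow> nat \<Rightarrow> (nat \<Rightarrow> nat) \<Rightarrow> (nat \<Rightarrow> nat) \<Rightarrow> real" where
  "hahn_kernel d \<kappa> N n = (SOME K. is_hahn_kernel d \<kappa> N n K)"

definition hahn_poisson ::
  "nat \<Rightarrow> (nat \<Rightarrow> real) \<Rightarrow> nat \<Rightarrow> real \<Rightarrow> (nat \<Rightarrow> nat) \<Rightarrow> (nat \<Rightarrow> nat) \<Rightarrow> real" where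
  "hahn_poisson d \<kappa> N r x y = (\<Sum>n\<le>N. hahn_kernel d \<kappa> N n x y * r ^ n)"

definition hahn_E ::
  "nat \<Rightarrow> (nat \<Rightarrow> real) \<Rightarrow> nat \<Rightarrow> (nat \<Rightarrow> nat) \<Rightarrow> (nat \<Rightarrow> nat) \<Rightarrow> real" where
  "hahn_E d \<kappa> N x y =
     (\<Sum>\<gamma>\<in>lattice_simplex d N.
        vec_pochhammer d (\<lambda>i. - real (x i)) \<gamma> * vec_pochhammer d (\<lambda>i. - real (y i)) \<gamma> /
        (vec_pochhammer d (\<lambda>i. \<kappa> i + 1) \<gamma> * vec_fact d \<gamma>))"

end

theory Submission
  imports Defs
begin

text \<open>
  Let \<open>E\<^sub>m(x,y)\<close> be the sum defining \<open>\<E>\<close> with \<open>|\<gamma>| = m\<close>; it is nonnegative for every \<open>m\<close>.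
  The operator with kernel \<open>E\<^sub>m\<close> is an upward move (Polya urn) followed by a downward move
  (sampling without replacement). The first is diagonal on products of rising factorials,
  the second on products of falling factorials, so modulo lower degree \<open>E\<^sub>m\<close> multiplies a polynomial of degree
  \<open>n\<close> by a scalar \<open>\<mu>\<^sub>m\<^sub>n\<close>; being self-adjoint, it acts on the \<open>n\<close>-th Hahn space
  exactly as \<open>\<mu>\<^sub>m\<^sub>n\<close>, that is, \<open>E\<^sub>m = \<Sum>\<^sub>n \<mu>\<^sub>m\<^sub>n P\<^sub>n\<close>. Inverting the triangular system \<open>\<Sum>\<^sub>m c\<^sub>m(r) \<mu>\<^sub>m\<^sub>n = r\<^sup>n\<close>
  gives \<open>\<Phi>\<^sub>r = \<Sum>\<^sub>m c\<^sub>m(r) E\<^sub>m\<close>, where \<open>c\<^sub>m(r)\<close> is a very-well-poised \<open>\<^sub>3F\<^sub>2\<close> in \<open>r\<close>. Expanded in powers of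
  \<open>1 - r\<close> its coefficients become differences of binomial coefficients and are nonnegative.
  At \<open>r = 1\<close> the kernel is that of the identity, as is \<open>E\<^sub>N\<close> up to a constant factor.
\<close>

section \<open>The coefficients of the Poisson kernel\<close>

text \<open>Pascal's rule and an index shift. The sum is, up to sign, a finite difference of
  \<open>p\<close> at 0 of order \<open>Suc L\<close>; taking one difference inside lets an
  induction on the order act on \<open>p\<close>.\<close>

lemma alternating_binomial_sum_Suc:
  fixes p :: "nat \<Rightarrow> real"
  shows "(\<Sum>j\<le>Suc L. (-1)^j * real (Suc L choose j) * p j) =
         (\<Sum>j\<le>L. (-1)^j * real (L choose j) * (p j - p (Suc j)))"
proof -
  have "(\<Sum>j\<le>Suc L. (-1)^j * real (Suc L choose j) * p j) =
        p 0 + (\<Sum>j\<le>L. (-1)^Suc j * real (Suc L choose Suc j) * p (Suc j))"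
    by (subst sum.atMost_Suc_shift) simp
  also have "\<dots> = (p 0 + (\<Sum>j\<le>L. (-1)^Suc j * real (L choose Suc j) * p (Suc j)))
        - (\<Sum>j\<le>L. (-1)^j * real (L choose j) * p (Suc j))"
    by (simp add: sum.distrib[symmetric] sum_negf[symmetric] algebra_simps)
  also have "p 0 + (\<Sum>j\<le>L. (-1)^Suc j * real (L choose Suc j) * p (Suc j)) =
        (\<Sum>j\<le>Suc L. (-1)^j * real (L choose j) * p j)"
    by (subst sum.atMost_Suc_shift) simp
  also have "\<dots> = (\<Sum>j\<le>L. (-1)^j * real (L choose j) * p j)"
    by simp
  finally show ?thesis
    by (simp add: sum_subtractf algebra_simps)
qed

text \<open>One difference in \<open>j\<close> turns the rising factorial of degree \<open>q\<close>
  into \<open>- q\<close> times one of degree \<open>q - 1\<close> with \<open>z\<close> moved to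
  \<open>z + 1\<close>, so more than \<open>q\<close> differences annihilate it.\<close>

lemma alternating_binomial_sum_pochhammer:
  fixes z :: real
  assumes "q < L"
  shows "(\<Sum>j\<le>L. (-1)^j * real (L choose j) * pochhammer (z + real j) q) = 0"
  using assms
proof (induction L arbitrary: z q)
  case (Suc L)
  show ?case
  proof (cases q)
    case 0
    then show ?thesis
      by (simp only: alternating_binomial_sum_Suc) simp
  next
    case (Suc q')
    have "pochhammer (z + real j) q - pochhammer (z + real (Suc j)) q
            = - real q * pochhammer (z + 1 + real j) q'" for j
      unfolding Suc pochhammer_rec[of "z + real j"] pochhammer_Suc[of "z + real (Suc j)"]
      by (simp add: algebra_simps)
    then have "(\<Sum>j\<le>Suc L. (-1)^j * real (Suc L choose j) * pochhammer (z + real j) q) =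
          - real q * (\<Sum>j\<le>L. (-1)^j * real (L choose j) * pochhammer (z + 1 + real j) q')"
      by (simp only: alternating_binomial_sum_Suc) (simp add: sum_distrib_left algebra_simps)
    also have "\<dots> = 0"
      using Suc.IH[of q' "z + 1"] Suc.prems Suc by simp
    finally show ?thesis .
  qed
qed simp

section \<open>Generating-function coefficients and positivity of well-poised sums\<close>

lemma pochhammer_div_fact_gbinomial:
  "pochhammer c k / fact k = (-1) ^ k * ((- c) gchoose k)" for c :: real
  by (simp add: gbinomial_pochhammer flip: power_mult_distrib)

text \<open>Chu-Vandermonde: the coefficient of X^i in (1 + X)^(-c) (1 + X)^b.\<close>

lemma gbinomial_pochhammer_convolution:
  fixes c :: real
  shows "(\<Sum>j\<le>i. (-1) ^ j * (pochhammer c j / fact j) * (b gchoose (i - j))) = (b - c) gchoose i"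
  using gbinomial_Vandermonde[of "-c" b i]
  by (simp add: pochhammer_div_fact_gbinomial atMost_atLeast0 flip: power_mult_distrib mult.assoc)

lemma binomial_pochhammer_shift:
  fixes c :: real
  assumes "k \<le> j"
  shows "real (j choose k) * (pochhammer c j / fact j) =
         pochhammer c k / fact k * (pochhammer (c + real k) (j - k) / fact (j - k))"
  using assms pochhammer_product[OF assms, of c] by (simp add: binomial_fact)

text \<open>Both sides are the coefficient of t^i in (1 + r t)^(-c) (1 + t)^b, on the right after 1
  + r t = (1 + t) (1 - (1 - r) t / (1 + t)). The proof stays with finite sums: \<open>- r\<close> is
  split as \<open>(1 - r) + (-1)\<close>, the powers are expanded, and the inner sum over
  \<open>j\<close> is a Chu-Vandermonde sum.\<close>

lemma truncated_binomial_expansion: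
  fixes c b r :: real
  shows "(\<Sum>j\<le>i. (- r) ^ j * (pochhammer c j / fact j) * (b gchoose (i - j))) =
         (\<Sum>k\<le>i. pochhammer c k / fact k * (1 - r) ^ k * ((b - c - real k) gchoose (i - k)))"
proof -
  define P where "P j = pochhammer c j / fact j" for j
  have "(- r) ^ j = (\<Sum>k\<le>j. real (j choose k) * (1 - r) ^ k * (-1) ^ (j - k))" for j
    using binomial_ring[of "1 - r" "-1" j] by simp
  then have "(\<Sum>j\<le>i. (- r) ^ j * P j * (b gchoose (i - j))) =
     (\<Sum>j\<le>i. \<Sum>k\<le>j. real (j choose k) * (1 - r) ^ k * (-1) ^ (j - k) * P j * (b gchoose (i - j)))"
    by (simp add: sum_distrib_right)
  also have "\<dots> = (\<Sum>k\<le>i. \<Sum>j\<in>{k..i}. real (j choose k) * (1 - r) ^ k * (-1) ^ (j - k) * P j * (b gchoose (i - j)))"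
    unfolding sum.Sigma[OF finite_atMost ballI[OF finite_atMost]]
      sum.Sigma[OF finite_atMost ballI[OF finite_atLeastAtMost]]
    by (rule sum.reindex_bij_witness[of _ prod.swap prod.swap]) auto
  also have "\<dots> = (\<Sum>k\<le>i. P k * (1 - r) ^ k * ((b - c - real k) gchoose (i - k)))"
  proof (rule sum.cong[OF refl])
    fix k assume "k \<in> {..i}"
    then have k: "k \<le> i" by simp
    have "(\<Sum>j\<in>{k..i}. real (j choose k) * (1 - r) ^ k * (-1) ^ (j - k) * P j * (b gchoose (i - j)))
        = (\<Sum>j\<in>{k..i}. P k * (1 - r) ^ k * ((-1) ^ (j - k) *
             (pochhammer (c + real k) (j - k) / fact (j - k)) * (b gchoose (i - j))))"
    proof (rule sum.cong[OF refl])
      fix j assume "j \<in> {k..i}"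
      then have "real (j choose k) * P j = P k * (pochhammer (c + real k) (j - k) / fact (j - k))"
        unfolding P_def by (intro binomial_pochhammer_shift) auto
      then have "(real (j choose k) * P j) * ((1 - r) ^ k * (-1) ^ (j - k) * (b gchoose (i - j))) =
          P k * (pochhammer (c + real k) (j - k) / fact (j - k)) *
            ((1 - r) ^ k * (-1) ^ (j - k) * (b gchoose (i - j)))"
        by simp
      then show "real (j choose k) * (1 - r) ^ k * (-1) ^ (j - k) * P j * (b gchoose (i - j)) =
          P k * (1 - r) ^ k * ((-1) ^ (j - k) *
             (pochhammer (c + real k) (j - k) / fact (j - k)) * (b gchoose (i - j)))"
        by (simp only: mult_ac)
    qed
    also have "\<dots> = P k * (1 - r) ^ k * (\<Sum>j\<in>{k..i}. (-1) ^ (j - k) *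
             (pochhammer (c + real k) (j - k) / fact (j - k)) * (b gchoose (i - j)))"
      by (simp add: sum_distrib_left)
    also have "(\<Sum>j\<in>{k..i}. (-1) ^ (j - k) *
             (pochhammer (c + real k) (j - k) / fact (j - k)) * (b gchoose (i - j)))
        = (\<Sum>j\<le>i-k. (-1) ^ j *
             (pochhammer (c + real k) j / fact j) * (b gchoose (i - k - j)))"
      using k by (intro sum.reindex_bij_witness[of _ "\<lambda>j. j + k" "\<lambda>j. j - k"]) auto
    also have "\<dots> = (b - c - real k) gchoose (i - k)"
      by (subst gbinomial_pochhammer_convolution) (simp add: algebra_simps)
    finally show "(\<Sum>j\<in>{k..i}. real (j choose k) * (1 - r) ^ k * (-1) ^ (j - k) * P j * (b gchoose (i - j)))
        = P k * (1 - r) ^ k * ((b - c - real k) gchoose (i - k))" .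
  qed
  finally show ?thesis by (simp add: P_def)
qed

text \<open>
  \<open>well_poised_coeff c\<close> is the coefficient sequence of \<open>(1 + X) (1 - X)\<^bsup>-c\<^esup>\<close>, so that \<open>well_poised_sum c M r\<close> is the coefficient
  of \<open>t\<^bsup>M\<^esup>\<close> in \<open>(1 - r t) (1 + r t)\<^bsup>-c\<^esup> (1 + t)\<^bsup>c+2M-1\<^esup>\<close>. Positivity comes from substituting
  \<open>1 + r t = (1 + t) (1 - (1 - r) t / (1 + t))\<close>.
\<close>

definition well_poised_coeff :: "real \<Rightarrow> nat \<Rightarrow> real" where
  "well_poised_coeff c j = pochhammer c j / fact j + (if j = 0 then 0 else pochhammer c (j - 1) / fact (j - 1))"

definition well_poised_sum :: "real \<Rightarrow> nat \<Rightarrow> real \<Rightarrow> real" where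
  "well_poised_sum c M r = (\<Sum>j\<le>M. (- r) ^ j * well_poised_coeff c j * ((c + 2 * real M - 1) gchoose (M - j)))"

text \<open>Neighbouring entries in one row of Pascal's triangle. For \<open>k > 0\<close> both lie
  in the increasing half, because 2 (M - k) \<le> 2 M - 1 - k; for \<open>k = 0\<close> they are the
  two equal central entries.\<close>

lemma choose_pred_le_choose:
  assumes "k < M"
  shows "(2 * M - 1 - k) choose (M - 1 - k) \<le> (2 * M - 1 - k) choose (M - k)"
proof (cases "k = 0")
  case True
  then have "(2 * M - 1) choose (M - 1) = (2 * M - 1) choose M"
    using assms by (subst binomial_symmetric) (auto simp: numeral_2_eq_2)
  then show ?thesis using True by simp
next
  case False
  with assms show ?thesis by (intro binomial_mono) auto
qed

text \<open>The factor 1 - r t of the generating function makes the sum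
  \<open>Q M - r * Q M'\<close> with \<open>M' = M - 1\<close>. In powers of \<open>1 - r\<close>
  all coefficients of \<open>Q M'\<close> are nonnegative, so \<open>Q M - Q M'\<close> is a lower
  bound, and this is nonnegative term by term.\<close>

lemma well_poised_sum_nonneg:
  assumes "c > 0" "0 \<le> r" "r \<le> 1"
  shows "well_poised_sum c M r \<ge> 0"
proof (cases M)
  case 0
  then show ?thesis by (simp add: well_poised_sum_def well_poised_coeff_def)
next
  case (Suc M')
  define b where "b = c + 2 * real M - 1"
  define Q where "Q i = (\<Sum>j\<le>i. (- r) ^ j * (pochhammer c j / fact j) * (b gchoose (i - j)))" for i
  define T where "T k = pochhammer c k / fact k * (1 - r) ^ k" for k
  have T: "T k \<ge> 0" for k
    using assms by (simp add: T_def pochhammer_nonneg)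
  have Q: "Q i = (\<Sum>k\<le>i. T k * real ((2 * M - 1 - k) choose (i - k)))" if "i \<le> M" for i
  proof -
    \<comment> \<open>The upper index \<open>c + 2 * real M - 1\<close> pays off here:
      \<open>b - c - k\<close> is the natural number \<open>2 * M - 1 - k\<close>, so the
      generalized binomial is an ordinary one.\<close>
    have "(b - c - real k) gchoose (i - k) = real ((2 * M - 1 - k) choose (i - k))" if "k \<le> i" for k
    proof -
      have "b - c - real k = real (2 * M - 1 - k)"
        using that \<open>i \<le> M\<close> Suc by (simp add: b_def of_nat_diff)
      then show ?thesis by (simp add: binomial_gbinomial)
    qed
    then show ?thesis
      unfolding Q_def truncated_binomial_expansion T_def by simp
  qed
  have "well_poised_sum c M r = Q M - r * Q M'"
  proof -
    have "well_poised_sum c M r = Q M + (\<Sum>j\<le>M. if j = 0 then 0 else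
        (- r) ^ j * (pochhammer c (j - 1) / fact (j - 1)) * (b gchoose (M - j)))"
      unfolding well_poised_sum_def well_poised_coeff_def Q_def b_def sum.distrib[symmetric]
      by (intro sum.cong) (auto simp: algebra_simps)
    also have "(\<Sum>j\<le>M. if j = 0 then 0 else
        (- r) ^ j * (pochhammer c (j - 1) / fact (j - 1)) * (b gchoose (M - j))) = - r * Q M'"
      unfolding Suc Q_def by (subst sum.atMost_Suc_shift) (simp add: sum_distrib_left algebra_simps)
    finally show ?thesis by simp
  qed
  also have "r * Q M' \<le> Q M'"
    using T Q[of M'] Suc assms by (intro mult_left_le_one_le) (auto intro!: sum_nonneg)
  then have "Q M - r * Q M' \<ge> Q M - Q M'" by simp
  \<comment> \<open>\<open>T M\<close> is the term \<open>k = M\<close> of \<open>Q M\<close>, which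
    has no counterpart in \<open>Q M'\<close>.\<close>
  also have "Q M - Q M' = T M + (\<Sum>k\<le>M'. T k * (real ((2 * M - 1 - k) choose (M - k)) -
      real ((2 * M - 1 - k) choose (M' - k))))"
    using Q[of M] Q[of M'] Suc by (simp add: sum_subtractf algebra_simps)
  also have "\<dots> \<ge> 0"
    using T choose_pred_le_choose[of _ M] Suc by (intro add_nonneg_nonneg sum_nonneg mult_nonneg_nonneg) auto
  finally show ?thesis by simp
qed

section \<open>Inversion of the triangular system of eigenvalues\<close>

text \<open>For \<open>j > 0\<close> the coefficient is
  \<open>pochhammer c (j - 1) * (c + 2 * j - 1) / fact j\<close>. At \<open>c = a + 2 * m\<close>
  and \<open>j = l - m\<close> the linear factor is \<open>a + 2 * l - 1\<close>, free of
  \<open>m\<close>, and the two rising factorials merge into one of degree \<open>l - n - 1\<close>.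
  For \<open>m = l\<close> the linear factor is instead the last factor of the rising
  factorial.\<close>

lemma well_poised_coeff_shift:
  fixes a :: real
  assumes "n \<le> m" "m \<le> l" "n < l"
  shows "pochhammer (a + real m + real n) (m - n) * well_poised_coeff (a + 2 * real m) (l - m) * fact (l - m) =
         (a + 2 * real l - 1) * pochhammer (a + real m + real n) (l - Suc n)"
proof (cases "m = l")
  case True
  obtain p where p: "l - n = Suc p" "l = n + Suc p"
    using assms by (metis less_imp_Suc_add add_Suc_right diff_add_inverse)
  show ?thesis
    unfolding True by (simp add: p well_poised_coeff_def pochhammer_Suc)
next
  case False
  then obtain j where j: "l = m + Suc j" using assms by (metis add_Suc_right le_neq_implies_less less_imp_Suc_add)
  obtain i where i: "m = n + i" using assms le_Suc_ex by blast
  have e: "l - Suc n = i + j" "l - m = Suc j" "m - n = i" using i j by auto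
  have f: "well_poised_coeff (a + 2 * real m) (Suc j) * fact (Suc j) =
        pochhammer (a + 2 * real m) j * (a + 2 * real l - 1)"
  proof -
    have "pochhammer c (Suc j) / fact (Suc j) * fact (Suc j) = pochhammer c j * (c + real j)" for c :: real
      by (simp only: pochhammer_Suc nonzero_mult_div_cancel_right fact_nonzero times_divide_eq_left not_False_eq_True)
    moreover have "pochhammer c j / fact j * fact (Suc j) = pochhammer c j * (1 + real j)" for c :: real
      by simp
    moreover have "well_poised_coeff c (Suc j) * fact (Suc j) =
        pochhammer c (Suc j) / fact (Suc j) * fact (Suc j) + pochhammer c j / fact j * fact (Suc j)" for c
      unfolding well_poised_coeff_def distrib_right by simp
    ultimately have "well_poised_coeff c (Suc j) * fact (Suc j) =
        pochhammer c j * (c + real j) + pochhammer c j * (1 + real j)" for c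
      by simp
    then show ?thesis
      by (simp add: j algebra_simps del: fact_Suc)
  qed
  have g: "pochhammer (a + real m + real n) (i + j) =
      pochhammer (a + real m + real n) i * pochhammer (a + 2 * real m) j"
    unfolding pochhammer_product' by (simp add: i add_ac)
  show ?thesis unfolding e g mult.assoc f by (simp only: mult_ac)
qed

text \<open>The inversion relation for the triangular system. For \<open>l > n\<close> the sum is a
  multiple of a difference of order \<open>l - n\<close> of a rising factorial of degree
  \<open>l - n - 1\<close>, hence zero.\<close>

lemma well_poised_orthogonality:
  fixes a :: real
  assumes "n \<le> l"
  shows "(\<Sum>m=n..l. (-1) ^ (l - m) * pochhammer (a + real m + real n) (m - n) *
            well_poised_coeff (a + 2 * real m) (l - m) / fact (m - n)) = (if l = n then 1 else 0)"
proof (cases "l = n")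
  case True
  then show ?thesis by (simp add: well_poised_coeff_def)
next
  case False
  with assms have nl: "n < l" by simp
  define z where "z = a + 2 * real n"
  have sg: "(-1) ^ (l - m) = (-1) ^ (l - n) * (-1 :: real) ^ (m - n)" if "n \<le> m" "m \<le> l" for m
  proof -
    have "l - n = (l - m) + (m - n)" using that by simp
    then show ?thesis by (simp add: power_add mult.assoc flip: power_mult_distrib)
  qed
  have "(\<Sum>m=n..l. (-1) ^ (l - m) * pochhammer (a + real m + real n) (m - n) *
            well_poised_coeff (a + 2 * real m) (l - m) / fact (m - n)) =
     (\<Sum>m=n..l. (-1) ^ (l - n) * (a + 2 * real l - 1) / fact (l - n) *
        ((-1) ^ (m - n) * real ((l - n) choose (m - n)) * pochhammer (a + real m + real n) (l - Suc n)))"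
  proof (rule sum.cong[OF refl])
    fix m assume "m \<in> {n..l}"
    then have m: "n \<le> m" "m \<le> l" by auto
    have ch: "real ((l - n) choose (m - n)) = fact (l - n) / (fact (m - n) * fact (l - m))"
      using m by (subst binomial_fact) auto
    have "pochhammer (a + real m + real n) (m - n) * well_poised_coeff (a + 2 * real m) (l - m) =
         (a + 2 * real l - 1) * pochhammer (a + real m + real n) (l - Suc n) / fact (l - m)"
      using well_poised_coeff_shift[OF m nl, of a] by (simp add: field_simps)
    then have "(-1) ^ (l - m) * (pochhammer (a + real m + real n) (m - n) *
            well_poised_coeff (a + 2 * real m) (l - m)) / fact (m - n) =
       (-1) ^ (l - n) * (a + 2 * real l - 1) / fact (l - n) *
        ((-1) ^ (m - n) * real ((l - n) choose (m - n)) * pochhammer (a + real m + real n) (l - Suc n))"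
      unfolding ch sg[OF m] by (simp, simp add: mult_ac)
    then show "(-1) ^ (l - m) * pochhammer (a + real m + real n) (m - n) *
            well_poised_coeff (a + 2 * real m) (l - m) / fact (m - n) =
       (-1) ^ (l - n) * (a + 2 * real l - 1) / fact (l - n) *
        ((-1) ^ (m - n) * real ((l - n) choose (m - n)) * pochhammer (a + real m + real n) (l - Suc n))"
      by (simp only: mult.assoc)
  qed
  also have "\<dots> = (-1) ^ (l - n) * (a + 2 * real l - 1) / fact (l - n) *
       (\<Sum>m=n..l. (-1) ^ (m - n) * real ((l - n) choose (m - n)) * pochhammer (a + real m + real n) (l - Suc n))"
    by (simp add: sum_distrib_left)
  also have "(\<Sum>m=n..l. (-1) ^ (m - n) * real ((l - n) choose (m - n)) * pochhammer (a + real m + real n) (l - Suc n))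
      = (\<Sum>j\<le>l-n. (-1) ^ j * real ((l - n) choose j) * pochhammer (z + real j) (l - Suc n))"
    using nl by (intro sum.reindex_bij_witness[of _ "\<lambda>j. j + n" "\<lambda>j. j - n"])
       (auto simp: z_def of_nat_diff algebra_simps)
  also have "\<dots> = 0"
    using nl by (intro alternating_binomial_sum_pochhammer) auto
  finally show ?thesis using False by simp
qed

text \<open>The scalar \<open>\<mu>\<^sub>m\<^sub>n\<close>, with \<open>a\<close> standing for
  |\<kappa>| + d + 1. The rising factorial over \<open>fact (N - m)\<close> comes from the upward
  move, the binomial coefficient from the downward move.\<close>

definition hahn_eigenvalue :: "real \<Rightarrow> nat \<Rightarrow> nat \<Rightarrow> nat \<Rightarrow> real" where
  "hahn_eigenvalue a N m n =
     (if n \<le> m then fact N / pochhammer a N *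
        (pochhammer (a + real m + real n) (N - m) / fact (N - m)) *
        ((real N - real n) gchoose (m - n)) else 0)"

text \<open>A solution \<open>c\<^sub>m(r)\<close> of the triangular system. Together with
  \<open>r ^ m\<close>, the terms of \<open>well_poised_sum\<close> are, up to scaling, entries of
  the inverse matrix times powers of \<open>r\<close>.\<close>

definition poisson_weight :: "real \<Rightarrow> nat \<Rightarrow> nat \<Rightarrow> real \<Rightarrow> real" where
  "poisson_weight a N m r =
     r ^ m * pochhammer (a + real m) m * pochhammer a N * fact (N - m) ^ 2 /
       (pochhammer (a + real N) N * fact N * pochhammer (a + real m) (N - m)) *
     well_poised_sum (a + 2 * real m) (N - m) r"

lemma poisson_weight_nonneg:
  assumes "a > 0" "0 \<le> r" "r \<le> 1"
  shows "poisson_weight a N m r \<ge> 0"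
  using assms unfolding poisson_weight_def
  by (intro mult_nonneg_nonneg divide_nonneg_nonneg well_poised_sum_nonneg pochhammer_nonneg zero_le_power) auto

text \<open>Isolates the summand of \<open>well_poised_orthogonality\<close> as the only part
  depending on \<open>m\<close>. With \<open>l = m + j\<close>, the upper index (a + 2 m) + 2 (N -
  m) - 1 of the binomial in \<open>well_poised_sum\<close> becomes a + 2 N - 1, free of
  \<open>m\<close>.\<close>

lemma poisson_weight_eigenvalue:
  assumes a: "a > 0" and nm: "n \<le> m" "m \<le> N"
  shows "poisson_weight a N m r * hahn_eigenvalue a N m n =
    (\<Sum>l=m..N. fact (N - n) * pochhammer (a + real N) n / pochhammer (a + real N) N *
       ((a + 2 * real N - 1) gchoose (N - l)) * r ^ l *
      ((-1) ^ (l - m) * pochhammer (a + real m + real n) (m - n) *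
            well_poised_coeff (a + 2 * real m) (l - m) / fact (m - n)))"
proof -
  define W where "W = well_poised_sum (a + 2 * real m) (N - m) r"
  define K where "K = fact (N - n) * pochhammer (a + real N) n / pochhammer (a + real N) N *
       pochhammer (a + real m + real n) (m - n) / fact (m - n)"
  have pos: "pochhammer (a + real i) j > 0" for i j using a by (intro pochhammer_pos) auto
  have pos0: "pochhammer a j > 0" for j using a by (intro pochhammer_pos) auto
  have nz: "pochhammer (a + real i) j \<noteq> 0" "pochhammer a j \<noteq> 0" for i j
    using pos[of i j] pos0[of j] by auto
  have gb: "(real N - real n) gchoose (m - n) = fact (N - n) / (fact (m - n) * fact (N - m))"
    using nm binomial_gbinomial[of "N - n" "m - n", where 'a = real, symmetric]
    by (simp add: of_nat_diff binomial_fact)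
  have e1: "pochhammer (a + real m) m = pochhammer (a + real m) n * pochhammer (a + real m + real n) (m - n)"
    using nm by (intro pochhammer_product) auto
  \<comment> \<open>Both sides are the rising factorial of \<open>a + m\<close> of length
    \<open>N - m + n\<close>, cut at two different places.\<close>
  have e2: "pochhammer (a + real m) n * pochhammer (a + real m + real n) (N - m) =
        pochhammer (a + real m) (N - m) * pochhammer (a + real N) n"
    using pochhammer_product'[of "a + real m" n "N - m"] pochhammer_product'[of "a + real m" "N - m" n] nm
    by (simp add: add_ac of_nat_diff)
  have "poisson_weight a N m r * hahn_eigenvalue a N m n = r ^ m * W * fact (N - n) *
       pochhammer (a + real m + real n) (m - n) / fact (m - n) / pochhammer (a + real N) N *
      (pochhammer (a + real m) n * pochhammer (a + real m + real n) (N - m) / pochhammer (a + real m) (N - m))"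
    unfolding poisson_weight_def hahn_eigenvalue_def gb e1 W_def[symmetric]
    using nm nz by (simp add: field_simps power2_eq_square)
  also have "\<dots> = K * r ^ m * W"
    unfolding e2 K_def using nz by (simp add: mult_ac)
  also have "r ^ m * W = (\<Sum>l=m..N. r ^ l * (-1) ^ (l - m) * well_poised_coeff (a + 2 * real m) (l - m)
       * ((a + 2 * real N - 1) gchoose (N - l)))"
    unfolding W_def well_poised_sum_def sum_distrib_left
    using nm
    by (intro sum.reindex_bij_witness[of _ "\<lambda>l. l - m" "\<lambda>j. j + m"])
       (auto simp: of_nat_diff power_add add_diff_eq diff_diff_left add_ac mult_ac distrib_left power_minus[of r])
  then have "K * r ^ m * W = K * (\<Sum>l=m..N. r ^ l * (-1) ^ (l - m) * well_poised_coeff (a + 2 * real m) (l - m)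
       * ((a + 2 * real N - 1) gchoose (N - l)))"
    by (simp only: mult.assoc)
  finally show ?thesis
    by (simp add: sum_distrib_left K_def mult_ac)
qed

text \<open>After exchanging the sums over n \<le> m \<le> l \<le> N, orthogonality leaves only
  \<open>l = n\<close>, where all constants cancel.\<close>

lemma sum_poisson_weight_eigenvalue:
  assumes a: "a > 0" and n: "n \<le> N"
  shows "(\<Sum>m\<le>N. poisson_weight a N m r * hahn_eigenvalue a N m n) = r ^ n"
proof -
  define A where "A l = fact (N - n) * pochhammer (a + real N) n / pochhammer (a + real N) N *
       ((a + 2 * real N - 1) gchoose (N - l)) * r ^ l" for l
  define B where "B l m = (-1) ^ (l - m) * pochhammer (a + real m + real n) (m - n) *
            well_poised_coeff (a + 2 * real m) (l - m) / fact (m - n)" for l m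
  have "(\<Sum>m\<le>N. poisson_weight a N m r * hahn_eigenvalue a N m n) =
        (\<Sum>m=n..N. poisson_weight a N m r * hahn_eigenvalue a N m n)"
    by (rule sum.mono_neutral_right) (auto simp: hahn_eigenvalue_def)
  also have "\<dots> = (\<Sum>m=n..N. \<Sum>l=m..N. A l * B l m)"
    unfolding A_def B_def by (intro sum.cong[OF refl] poisson_weight_eigenvalue a) auto
  also have "\<dots> = (\<Sum>(m, l)\<in>Sigma {n..N} (\<lambda>m. {m..N}). A l * B l m)"
    by (rule sum.Sigma) auto
  also have "\<dots> = (\<Sum>(l, m)\<in>Sigma {n..N} (\<lambda>l. {n..l}). A l * B l m)"
    by (rule sum.reindex_bij_witness[of _ prod.swap prod.swap]) auto
  also have "\<dots> = (\<Sum>l=n..N. A l * (\<Sum>m=n..l. B l m))"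
    by (simp add: sum.Sigma[symmetric] sum_distrib_left)
  also have "\<dots> = (\<Sum>l=n..N. if l = n then A l else 0)"
    unfolding B_def by (intro sum.cong[OF refl]) (simp add: well_poised_orthogonality)
  also have "\<dots> = A n" using n by simp
  also have "\<dots> = r ^ n"
  proof -
    have "(a + 2 * real N - 1) gchoose (N - n) = pochhammer (a + real N + real n) (N - n) / fact (N - n)"
      unfolding gbinomial_pochhammer' using n by (simp add: of_nat_diff algebra_simps)
    moreover have "pochhammer (a + real N) N = pochhammer (a + real N) n * pochhammer (a + real N + real n) (N - n)"
      using n by (rule pochhammer_product)
    moreover have "pochhammer (a + real N) n > 0" "pochhammer (a + real N + real n) (N - n) > 0"
      using a by (auto intro!: pochhammer_pos)
    ultimately show ?thesis by (simp add: A_def)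
  qed
  finally show ?thesis .
qed

section \<open>Polynomials on the lattice simplex\<close>

text \<open>
  Degrees are bounded strictly, so that degree at most \<open>n - 1\<close> is expressed by the bound \<open>n\<close>, and
  the bound \<open>0\<close> leaves only the zero polynomial.
\<close>

definition exponents_lt :: "nat \<Rightarrow> nat \<Rightarrow> (nat \<Rightarrow> nat) set" where
  "exponents_lt d n = {\<gamma>. (\<forall>i\<ge>d. \<gamma> i = 0) \<and> (\<Sum>i<d. \<gamma> i) < n}"

text \<open>One family for three bases: nodes 0 give monomials, nodes \<open>k\<close> falling
  factorials, nodes \<open>- (c i + k)\<close> rising factorials.\<close>

definition newton_prod :: "nat \<Rightarrow> (nat \<Rightarrow> nat \<Rightarrow> real) \<Rightarrow> (nat \<Rightarrow> nat) \<Rightarrow> (nat \<Rightarrow> nat) \<Rightarrow> real" where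
  "newton_prod d t \<gamma> x = (\<Prod>i<d. \<Prod>k<\<gamma> i. real (x i) - t i k)"

definition newton_span :: "nat \<Rightarrow> (nat \<Rightarrow> nat \<Rightarrow> real) \<Rightarrow> nat \<Rightarrow> ((nat \<Rightarrow> nat) \<Rightarrow> real) set" where
  "newton_span d t n = {f. \<exists>c. \<forall>x. f x = (\<Sum>\<gamma>\<in>exponents_lt d n. c \<gamma> * newton_prod d t \<gamma> x)}"

lemma finite_bounded_support:
  "finite {\<gamma> :: nat \<Rightarrow> nat. (\<forall>i\<ge>d. \<gamma> i = 0) \<and> (\<forall>i<d. \<gamma> i \<le> n)}"
proof (rule finite_subset)
  show "{\<gamma>. (\<forall>i\<ge>d. \<gamma> i = 0) \<and> (\<forall>i<d. \<gamma> i \<le> n)} \<subseteq>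
      {f. \<forall>i. (i \<in> {..<d} \<longrightarrow> f i \<in> {..n}) \<and> (i \<notin> {..<d} \<longrightarrow> f i = 0)}"
    by auto
  show "finite {f. \<forall>i. (i \<in> {..<d} \<longrightarrow> f i \<in> {..n}) \<and> (i \<notin> {..<d} \<longrightarrow> f i = (0::nat))}"
    by (rule finite_set_of_finite_funs) auto
qed

lemma finite_exponents_lt [simp]: "finite (exponents_lt d n)"
proof (rule finite_subset[OF _ finite_bounded_support[of d n]])
  show "exponents_lt d n \<subseteq> {\<gamma>. (\<forall>i\<ge>d. \<gamma> i = 0) \<and> (\<forall>i<d. \<gamma> i \<le> n)}"
  proof safe
    fix \<gamma> i assume g: "\<gamma> \<in> exponents_lt d n" "i < d"
    then have "\<gamma> i \<le> (\<Sum>i<d. \<gamma> i)" by (intro member_le_sum) auto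
    with g show "\<gamma> i \<le> n" by (auto simp: exponents_lt_def)
  qed (auto simp: exponents_lt_def)
qed

lemma finite_lattice_simplex [simp]: "finite (lattice_simplex d N)"
proof (rule finite_subset[OF _ finite_bounded_support[of "Suc d" N]])
  show "lattice_simplex d N \<subseteq> {\<gamma>. (\<forall>i\<ge>Suc d. \<gamma> i = 0) \<and> (\<forall>i<Suc d. \<gamma> i \<le> N)}"
    by (auto simp: lattice_simplex_def less_Suc_eq_le intro!: member_le_sum)
qed

lemma newton_span_zero [simp]: "(\<lambda>_. 0) \<in> newton_span d t n"
  unfolding newton_span_def by (auto intro!: exI[of _ "\<lambda>_. 0"])

lemma newton_span_add:
  assumes "f \<in> newton_span d t n" "g \<in> newton_span d t n"
  shows "(\<lambda>x. f x + g x) \<in> newton_span d t n"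
proof -
  obtain c c' where "\<forall>x. f x = (\<Sum>\<gamma>\<in>exponents_lt d n. c \<gamma> * newton_prod d t \<gamma> x)"
      "\<forall>x. g x = (\<Sum>\<gamma>\<in>exponents_lt d n. c' \<gamma> * newton_prod d t \<gamma> x)"
    using assms unfolding newton_span_def by blast
  then show ?thesis
    unfolding newton_span_def
    by (auto intro!: exI[of _ "\<lambda>\<gamma>. c \<gamma> + c' \<gamma>"] simp: distrib_right sum.distrib)
qed

lemma newton_span_scale:
  assumes "f \<in> newton_span d t n"
  shows "(\<lambda>x. b * f x) \<in> newton_span d t n"
proof -
  obtain c where "\<forall>x. f x = (\<Sum>\<gamma>\<in>exponents_lt d n. c \<gamma> * newton_prod d t \<gamma> x)"
    using assms unfolding newton_span_def by blast
  then show ?thesis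
    unfolding newton_span_def
    by (auto intro!: exI[of _ "\<lambda>\<gamma>. b * c \<gamma>"] simp: sum_distrib_left mult.assoc)
qed

lemma newton_span_sum:
  assumes "\<And>s. s \<in> S \<Longrightarrow> f s \<in> newton_span d t n"
  shows "(\<lambda>x. \<Sum>s\<in>S. f s x) \<in> newton_span d t n"
  using assms by (induction S rule: infinite_finite_induct) (auto intro: newton_span_add)

lemma newton_prod_in_span:
  assumes "\<gamma> \<in> exponents_lt d n"
  shows "newton_prod d t \<gamma> \<in> newton_span d t n"
  unfolding newton_span_def using assms
  by (auto intro!: exI[of _ "\<lambda>\<beta>. if \<beta> = \<gamma> then 1 else 0"] simp: if_distrib[of "\<lambda>c. c * _"] cong: if_cong)

lemma newton_span_mono:
  assumes "f \<in> newton_span d t m" "m \<le> n"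
  shows "f \<in> newton_span d t n"
proof -
  obtain c where c: "f = (\<lambda>x. \<Sum>\<gamma>\<in>exponents_lt d m. c \<gamma> * newton_prod d t \<gamma> x)"
    using assms unfolding newton_span_def by blast
  have "exponents_lt d m \<subseteq> exponents_lt d n"
    using assms by (auto simp: exponents_lt_def)
  then show ?thesis
    unfolding c by (intro newton_span_sum newton_span_scale newton_prod_in_span) auto
qed

lemma newton_prod_Suc:
  assumes "i < d"
  shows "newton_prod d t (\<gamma>(i := Suc (\<gamma> i))) x = (real (x i) - t i (\<gamma> i)) * newton_prod d t \<gamma> x"
  using assms unfolding newton_prod_def
  by (simp add: prod.remove[of "{..<d}" i] mult.commute)

lemma exponents_lt_Suc:
  assumes "\<gamma> \<in> exponents_lt d n" "i < d"
  shows "\<gamma>(i := Suc (\<gamma> i)) \<in> exponents_lt d (Suc n)"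
  using assms by (auto simp: exponents_lt_def sum.remove[of "{..<d}" i])

text \<open>On the basis element of exponent \<open>\<gamma>\<close>, \<open>x i - b\<close> is
  split at the next node as \<open>(x i - t i (\<gamma> i)) + (t i (\<gamma> i) - b)\<close>: the
  first part raises the exponent, the second is a scalar.\<close>

lemma newton_span_mult:
  assumes "f \<in> newton_span d t n" "i < d"
  shows "(\<lambda>x. (real (x i) - b) * f x) \<in> newton_span d t (Suc n)"
proof -
  obtain c where c: "f = (\<lambda>x. \<Sum>\<gamma>\<in>exponents_lt d n. c \<gamma> * newton_prod d t \<gamma> x)"
    using assms unfolding newton_span_def by blast
  have "(real (x i) - b) * f x = (\<Sum>\<gamma>\<in>exponents_lt d n. c \<gamma> * newton_prod d t (\<gamma>(i := Suc (\<gamma> i))) x)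
      + (\<Sum>\<gamma>\<in>exponents_lt d n. c \<gamma> * (t i (\<gamma> i) - b) * newton_prod d t \<gamma> x)" for x
    unfolding newton_prod_Suc[OF assms(2)] c
    by (simp add: sum_distrib_left sum.distrib[symmetric] algebra_simps)
  moreover have "(\<lambda>x. (\<Sum>\<gamma>\<in>exponents_lt d n. c \<gamma> * newton_prod d t (\<gamma>(i := Suc (\<gamma> i))) x)
      + (\<Sum>\<gamma>\<in>exponents_lt d n. c \<gamma> * (t i (\<gamma> i) - b) * newton_prod d t \<gamma> x)) \<in> newton_span d t (Suc n)"
    using assms
    by (intro newton_span_add newton_span_sum newton_span_scale newton_prod_in_span exponents_lt_Suc)
       (auto simp: exponents_lt_def)
  ultimately show ?thesis by simp
qed

lemma newton_span_const: "(\<lambda>_. b) \<in> newton_span d t (Suc n)"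
proof -
  have "newton_prod d t (\<lambda>_. 0) \<in> newton_span d t (Suc n)"
    by (intro newton_prod_in_span) (auto simp: exponents_lt_def)
  from newton_span_scale[OF this, of b] show ?thesis by (simp add: newton_prod_def)
qed

lemma newton_prod_in_other_span:
  assumes "\<gamma> \<in> exponents_lt d n"
  shows "newton_prod d t' \<gamma> \<in> newton_span d t n"
  using assms
proof (induction n arbitrary: \<gamma>)
  case 0
  then show ?case by (simp add: exponents_lt_def)
next
  case (Suc n)
  show ?case
  proof (cases "\<exists>i<d. \<gamma> i > 0")
    case False
    then have "newton_prod d t' \<gamma> = (\<lambda>_. 1)" by (auto simp: newton_prod_def fun_eq_iff)
    then show ?thesis by (simp add: newton_span_const)
  next
    case True
    then obtain i j where i: "i < d" "\<gamma> i = Suc j" by (metis gr0_conv_Suc)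
    define \<beta> where "\<beta> = \<gamma>(i := j)"
    have eq: "\<gamma> = \<beta>(i := Suc (\<beta> i))" using i by (auto simp: \<beta>_def)
    have "\<beta> \<in> exponents_lt d n"
      using Suc.prems i by (auto simp: exponents_lt_def \<beta>_def sum.remove[of "{..<d}" i])
    then have "(\<lambda>x. (real (x i) - t' i (\<beta> i)) * newton_prod d t' \<beta> x) \<in> newton_span d t (Suc n)"
      using i Suc.IH by (intro newton_span_mult) auto
    then show ?thesis
      by (subst eq) (simp add: newton_prod_Suc[OF i(1), abs_def])
  qed
qed

text \<open>Permits a change of basis under the same degree bound, so that each move can be read off
  in the basis where it is diagonal.\<close>

lemma newton_span_nodes_irrelevant: "newton_span d t n = newton_span d t' n"
proof -
  have "newton_span d t n \<subseteq> newton_span d t' n" for t t'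
  proof
    fix f assume "f \<in> newton_span d t n"
    then obtain c where "f = (\<lambda>x. \<Sum>\<gamma>\<in>exponents_lt d n. c \<gamma> * newton_prod d t \<gamma> x)"
      unfolding newton_span_def by blast
    then show "f \<in> newton_span d t' n"
      by (auto intro!: newton_span_sum newton_span_scale newton_prod_in_other_span)
  qed
  then show ?thesis by blast
qed

definition simplex_polys :: "nat \<Rightarrow> nat \<Rightarrow> nat \<Rightarrow> ((nat \<Rightarrow> nat) \<Rightarrow> real) set" where
  "simplex_polys d N n = {f. \<exists>g\<in>newton_span d (\<lambda>_ _. 0) n. \<forall>x\<in>lattice_simplex d N. f x = g x}"

lemma hahn_polys_eq: "hahn_polys d N n = simplex_polys d N (Suc n)"
proof -
  have "exponents_le d n = exponents_lt d (Suc n)"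
    by (auto simp: exponents_le_def exponents_lt_def)
  then show ?thesis
    unfolding hahn_polys_def simplex_polys_def newton_span_def newton_prod_def by fastforce
qed

lemma simplex_polysI:
  "g \<in> newton_span d t n \<Longrightarrow> (\<And>x. x \<in> lattice_simplex d N \<Longrightarrow> f x = g x) \<Longrightarrow> f \<in> simplex_polys d N n"
  unfolding simplex_polys_def using newton_span_nodes_irrelevant by blast

lemma simplex_polysE:
  assumes "f \<in> simplex_polys d N n"
  obtains c where "\<And>x. x \<in> lattice_simplex d N \<Longrightarrow>
     f x = (\<Sum>\<gamma>\<in>exponents_lt d n. c \<gamma> * newton_prod d t \<gamma> x)"
proof -
  obtain g where "g \<in> newton_span d t n" "\<forall>x\<in>lattice_simplex d N. f x = g x"
    using assms newton_span_nodes_irrelevant unfolding simplex_polys_def by blast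
  then show ?thesis
    using that unfolding newton_span_def by auto
qed

lemma simplex_polys_zero: "f \<in> simplex_polys d N 0 \<Longrightarrow> x \<in> lattice_simplex d N \<Longrightarrow> f x = 0"
  by (auto simp: simplex_polys_def newton_span_def exponents_lt_def)

lemma simplex_polys_cong:
  "f \<in> simplex_polys d N n \<Longrightarrow> (\<And>x. x \<in> lattice_simplex d N \<Longrightarrow> f x = g x) \<Longrightarrow> g \<in> simplex_polys d N n"
  unfolding simplex_polys_def by simp

lemma simplex_polys_mono: "f \<in> simplex_polys d N m \<Longrightarrow> m \<le> n \<Longrightarrow> f \<in> simplex_polys d N n"
  unfolding simplex_polys_def using newton_span_mono by blast

lemma simplex_polys_add:
  assumes "f \<in> simplex_polys d N n" "g \<in> simplex_polys d N n"
  shows "(\<lambda>x. f x + g x) \<in> simplex_polys d N n"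
proof -
  obtain f' g' where "f' \<in> newton_span d (\<lambda>_ _. 0) n" "\<forall>x\<in>lattice_simplex d N. f x = f' x"
      "g' \<in> newton_span d (\<lambda>_ _. 0) n" "\<forall>x\<in>lattice_simplex d N. g x = g' x"
    using assms unfolding simplex_polys_def by blast
  then show ?thesis
    by (intro simplex_polysI[OF newton_span_add]) auto
qed

lemma simplex_polys_scale:
  assumes "f \<in> simplex_polys d N n"
  shows "(\<lambda>x. b * f x) \<in> simplex_polys d N n"
proof -
  obtain g where "g \<in> newton_span d (\<lambda>_ _. 0) n" "\<forall>x\<in>lattice_simplex d N. f x = g x"
    using assms unfolding simplex_polys_def by blast
  then show ?thesis
    by (intro simplex_polysI[OF newton_span_scale]) auto
qed

lemma simplex_polys_diff:
  assumes "f \<in> simplex_polys d N n" "g \<in> simplex_polys d N n"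
  shows "(\<lambda>x. f x - g x) \<in> simplex_polys d N n"
  using simplex_polys_add[OF assms(1) simplex_polys_scale[OF assms(2), of "-1"]] by simp

section \<open>Indicator functions of points as polynomials of degree \<open>N\<close>\<close>

text \<open>Two distinct points with equal coordinate sums have some
  \<open>x i < \<gamma> i\<close>, and then the factor
  \<open>pochhammer (- x i) (\<gamma> i)\<close> vanishes.\<close>

lemma pochhammer_neg_simplex:
  assumes "x \<in> lattice_simplex d N" "\<gamma> \<in> lattice_simplex d N"
  shows "vec_pochhammer d (\<lambda>i. - real (x i)) \<gamma> = (if x = \<gamma> then (-1) ^ N * vec_fact d \<gamma> else 0)"
proof (cases "x = \<gamma>")
  case True
  then show ?thesis
    using assms by (auto simp: vec_pochhammer_def vec_fact_def pochhammer_same prod.distrib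
        lattice_simplex_def simp flip: power_sum)
next
  case False
  have "\<exists>i\<le>d. x i < \<gamma> i"
  proof (rule ccontr)
    assume "\<not> ?thesis"
    then have le: "\<And>i. i \<in> {..d} \<Longrightarrow> \<gamma> i \<le> x i" by (auto simp: not_less)
    have "(\<Sum>i\<le>d. \<gamma> i) = (\<Sum>i\<le>d. x i)" using assms by (simp add: lattice_simplex_def)
    then have "\<gamma> i = x i" if "i \<le> d" for i
      using sum_mono_inv[of "\<gamma>" "{..d}" x, OF _ le] that by simp
    moreover have "\<gamma> i = x i" if "\<not> i \<le> d" for i
      using assms that by (simp add: lattice_simplex_def)
    ultimately have "x i = \<gamma> i" for i by metis
    then show False using False by (simp add: fun_eq_iff)
  qed
  then show ?thesis
    using False by (auto simp: vec_pochhammer_def pochhammer_of_nat_eq_0_iff)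
qed

lemma newton_span_linear_mult:
  assumes "f \<in> newton_span d t n"
  shows "(\<lambda>x. ((\<Sum>i<d. real (x i)) + b) * f x) \<in> newton_span d t (Suc n)"
proof -
  have "(\<lambda>x. (\<Sum>i<d. (real (x i) - 0) * f x) + b * f x) \<in> newton_span d t (Suc n)"
    using assms newton_span_mono[OF assms, of "Suc n"]
    by (intro newton_span_add newton_span_sum newton_span_mult newton_span_scale) auto
  then show ?thesis by (simp add: distrib_right sum_distrib_right)
qed

text \<open>Used with \<open>b = - N\<close>: on the simplex the sum plus \<open>b\<close> is then
  \<open>- x d\<close>, so the factor of the last coordinate is a polynomial of degree at most
  \<open>k\<close> in the first \<open>d\<close>.\<close>

lemma newton_span_pochhammer_mult:
  assumes "f \<in> newton_span d t n"
  shows "(\<lambda>x. pochhammer ((\<Sum>i<d. real (x i)) + b) k * f x) \<in> newton_span d t (n + k)"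
proof (induction k)
  case (Suc k)
  have "pochhammer ((\<Sum>i<d. real (x i)) + b) (Suc k) * f x = ((\<Sum>i<d. real (x i)) + (b + real k)) *
        (pochhammer ((\<Sum>i<d. real (x i)) + b) k * f x)" for x
    by (simp add: pochhammer_Suc algebra_simps)
  then show ?case using newton_span_linear_mult[OF Suc, of "b + real k"] by (simp only: add_Suc_right)
qed (use assms in simp)

text \<open>On the simplex this function is a nonzero multiple of the indicator of \<open>y\<close>,
  so the lemma will show that every function there has degree at most \<open>N\<close>.\<close>

lemma vec_pochhammer_neg_in_simplex_polys:
  assumes "y \<in> lattice_simplex d N"
  shows "(\<lambda>x. vec_pochhammer d (\<lambda>i. - real (x i)) y) \<in> simplex_polys d N (Suc N)"
proof -
  define t where "t = (\<lambda>(_::nat) k. real k)"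
  define \<beta> where "\<beta> = y(d := 0)"
  have sy: "(\<Sum>i<d. y i) + y d = N"
    using assms by (simp add: lattice_simplex_def lessThan_Suc_atMost[symmetric])
  have p: "(\<Prod>k<j. real n - real k) * (-1) ^ j = pochhammer (- real n) j" for n j
    by (induction j) (simp_all add: pochhammer_Suc algebra_simps)
  have "\<beta> \<in> exponents_lt d (Suc (\<Sum>i<d. y i))"
    using assms by (auto simp: exponents_lt_def \<beta>_def lattice_simplex_def)
  then have "newton_prod d t \<beta> \<in> newton_span d t (Suc (\<Sum>i<d. y i))"
    by (rule newton_prod_in_span)
  then have "(\<lambda>x. (-1) ^ (\<Sum>i<d. y i) * (pochhammer ((\<Sum>i<d. real (x i)) + (- real N)) (y d) * newton_prod d t \<beta> x))
      \<in> newton_span d t (Suc (\<Sum>i<d. y i) + y d)"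
    by (intro newton_span_scale newton_span_pochhammer_mult)
  moreover have "Suc (\<Sum>i<d. y i) + y d = Suc N" using sy by simp
  moreover have "vec_pochhammer d (\<lambda>i. - real (x i)) y =
     (-1) ^ (\<Sum>i<d. y i) * (pochhammer ((\<Sum>i<d. real (x i)) + (- real N)) (y d) * newton_prod d t \<beta> x)"
    if "x \<in> lattice_simplex d N" for x
  proof -
    have "(\<Sum>i<d. real (x i)) + real (x d) = real N"
      using that unfolding lattice_simplex_def
      by (auto simp: lessThan_Suc_atMost[symmetric] simp flip: of_nat_sum of_nat_add)
    then have "(\<Sum>i<d. real (x i)) + (- real N) = - real (x d)" by simp
    then show ?thesis
      unfolding vec_pochhammer_def newton_prod_def t_def \<beta>_def lessThan_Suc_atMost[symmetric]
      by (simp add: p[symmetric] prod.distrib power_sum[symmetric] power_add)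
  qed
  ultimately show ?thesis by (intro simplex_polysI) simp_all
qed

section \<open>Sums over the lattice simplex\<close>

text \<open>A Cauchy product of generating series, one coordinate at a time.\<close>

lemma sum_lattice_simplex_prod:
  fixes h :: "nat \<Rightarrow> nat \<Rightarrow> real"
  shows "(\<Sum>z\<in>lattice_simplex d M. \<Prod>i\<le>d. h i (z i)) = fps_nth (\<Prod>i\<le>d. Abs_fps (h i)) M"
proof (induction d arbitrary: M)
  case 0
  have "lattice_simplex 0 M = {(\<lambda>_. 0)(0 := M)}"
    by (auto simp: lattice_simplex_def fun_eq_iff)
  then show ?case by simp
next
  case (Suc d)
  have "(\<Sum>z\<in>lattice_simplex (Suc d) M. \<Prod>i\<le>Suc d. h i (z i)) =
     (\<Sum>(k, z)\<in>Sigma {0..M} (lattice_simplex d). (\<Prod>i\<le>d. h i (z i)) * h (Suc d) (M - k))"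
    by (rule sum.reindex_bij_witness[of _ "\<lambda>(k, z). z(Suc d := M - k)"
          "\<lambda>z. (M - z (Suc d), z(Suc d := 0))"])
       (auto simp: lattice_simplex_def fun_eq_iff)
  also have "\<dots> = (\<Sum>k=0..M. (\<Sum>z\<in>lattice_simplex d k. \<Prod>i\<le>d. h i (z i)) * h (Suc d) (M - k))"
    by (simp add: sum.Sigma[symmetric] sum_distrib_right)
  also have "\<dots> = fps_nth (\<Prod>i\<le>Suc d. Abs_fps (h i)) M"
    unfolding Suc.IH by (simp add: fps_mult_nth)
  finally show ?case .
qed

section \<open>Generating series and factorial moments\<close>

text \<open>The series (1 - X)^(-a).\<close>

definition fps_pochhammer :: "real \<Rightarrow> real fps" where
  "fps_pochhammer a = Abs_fps (\<lambda>k. pochhammer a k / fact k)"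

lemma fps_pochhammer_add: "fps_pochhammer (a + b) = fps_pochhammer a * fps_pochhammer b"
proof (rule fps_ext)
  fix n
  have "fps_nth (fps_pochhammer (a + b)) n =
      (\<Sum>k\<le>n. real (n choose k) * pochhammer a k * pochhammer b (n - k) / fact n)"
    by (simp add: fps_pochhammer_def pochhammer_binomial_sum sum_divide_distrib)
  also have "\<dots> = (\<Sum>k\<le>n. pochhammer a k / fact k * (pochhammer b (n - k) / fact (n - k)))"
    by (intro sum.cong[OF refl]) (simp add: binomial_fact)
  also have "\<dots> = fps_nth (fps_pochhammer a * fps_pochhammer b) n"
    by (simp add: fps_pochhammer_def fps_mult_nth atMost_atLeast0)
  finally show "fps_nth (fps_pochhammer (a + b)) n = fps_nth (fps_pochhammer a * fps_pochhammer b) n" .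
qed

lemma fps_pochhammer_sum:
  "finite S \<Longrightarrow> (\<Prod>i\<in>S. fps_pochhammer (a i)) = fps_pochhammer (\<Sum>i\<in>S. a i)"
proof (induction S rule: finite_induct)
  case empty
  show ?case by (rule fps_ext) (simp add: fps_pochhammer_def pochhammer_0_left)
qed (simp add: fps_pochhammer_add)

lemma pochhammer_neg_of_nat:
  "pochhammer (- real n) k = (-1) ^ k * fact k * real (n choose k)"
  using gbinomial_pochhammer[of "real n" k]
  by (simp add: binomial_gbinomial flip: power_mult_distrib)

text \<open>The left side is, up to the sign (-1)^g, X^g times the g-th derivative of (1 -
  X)^(-c).\<close>

lemma fps_pochhammer_falling:
  "Abs_fps (\<lambda>k. pochhammer c k / fact k * pochhammer (- real k) g) =
     fps_const ((-1) ^ g * pochhammer c g) * (fps_X ^ g * fps_pochhammer (c + real g))"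
proof (rule fps_ext)
  fix k
  show "fps_nth (Abs_fps (\<lambda>k. pochhammer c k / fact k * pochhammer (- real k) g)) k =
     fps_nth (fps_const ((-1) ^ g * pochhammer c g) * (fps_X ^ g * fps_pochhammer (c + real g))) k"
  proof (cases "k < g")
    case True
    then show ?thesis by (simp add: fps_X_power_mult_nth pochhammer_of_nat_eq_0_iff)
  next
    case False
    then have "pochhammer c k = pochhammer c g * pochhammer (c + real g) (k - g)"
      by (intro pochhammer_product) simp
    with False show ?thesis
      by (simp add: fps_X_power_mult_nth fps_pochhammer_def pochhammer_neg_of_nat binomial_fact)
  qed
qed

text \<open>Multivariate factorial moments, obtained by multiplying the one-coordinate series.
  Positive \<open>c\<close> gives the Polya urn; \<open>c = - x\<close> gives, up to sign and
  normalization, sampling without replacement. Both moves rest on this formula.\<close>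

lemma sum_lattice_simplex_pochhammer:
  "(\<Sum>z\<in>lattice_simplex d M. vec_pochhammer d c z / vec_fact d z * vec_pochhammer d (\<lambda>i. - real (z i)) g) =
   (-1) ^ (\<Sum>i\<le>d. g i) * vec_pochhammer d c g *
     (if (\<Sum>i\<le>d. g i) \<le> M
      then pochhammer ((\<Sum>i\<le>d. c i) + real (\<Sum>i\<le>d. g i)) (M - (\<Sum>i\<le>d. g i)) / fact (M - (\<Sum>i\<le>d. g i))
      else 0)"
proof -
  define h where "h i k = pochhammer (c i) k / fact k * pochhammer (- real k) (g i)" for i k
  have "(\<Sum>z\<in>lattice_simplex d M. vec_pochhammer d c z / vec_fact d z * vec_pochhammer d (\<lambda>i. - real (z i)) g)
     = (\<Sum>z\<in>lattice_simplex d M. \<Prod>i\<le>d. h i (z i))"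
    by (simp add: vec_pochhammer_def vec_fact_def h_def prod.distrib prod_dividef)
  also have "\<dots> = fps_nth (\<Prod>i\<le>d. Abs_fps (h i)) M"
    by (rule sum_lattice_simplex_prod)
  also have "(\<Prod>i\<le>d. Abs_fps (h i)) = fps_const (\<Prod>i\<le>d. (-1) ^ g i * pochhammer (c i) (g i)) *
      (fps_X ^ (\<Sum>i\<le>d. g i) * fps_pochhammer (\<Sum>i\<le>d. c i + real (g i)))"
  proof -
    have "(\<Prod>i\<in>S. fps_const (a i)) = fps_const (\<Prod>i\<in>S. a i)" for a :: "nat \<Rightarrow> real" and S
      by (induction S rule: infinite_finite_induct) simp_all
    then show ?thesis
      unfolding h_def fps_pochhammer_falling
      by (simp add: prod.distrib fps_pochhammer_sum power_sum del: fps_const_mult)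
  qed
  finally show ?thesis
    by (simp add: fps_X_power_mult_nth fps_pochhammer_def vec_pochhammer_def prod.distrib
        sum.distrib flip: power_sum)
qed

lemma prod_le_eq_prod_less:
  fixes f :: "nat \<Rightarrow> real"
  assumes "f d = 1"
  shows "(\<Prod>i\<le>d. f i) = (\<Prod>i<d. f i)"
  using assms by (simp add: lessThan_Suc_atMost[symmetric])

lemma newton_prod_falling:
  assumes "\<beta> \<in> exponents_lt d n"
  shows "newton_prod d (\<lambda>_. real) \<beta> x =
     (-1) ^ (\<Sum>i<d. \<beta> i) * vec_pochhammer d (\<lambda>i. - real (x i)) \<beta>"
proof -
  have p: "(\<Prod>k<j. real n - real k) = (-1) ^ j * pochhammer (- real n) j" for n j
    by (induction j) (simp_all add: pochhammer_Suc algebra_simps)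
  have "vec_pochhammer d (\<lambda>i. - real (x i)) \<beta> = (\<Prod>i<d. pochhammer (- real (x i)) (\<beta> i))"
    unfolding vec_pochhammer_def using assms
    by (intro prod_le_eq_prod_less) (simp add: exponents_lt_def)
  then show ?thesis
    by (simp add: newton_prod_def p prod.distrib power_sum)
qed

lemma newton_prod_rising:
  assumes "\<beta> \<in> exponents_lt d n"
  shows "newton_prod d (\<lambda>i k. - (c i + real k)) \<beta> x = vec_pochhammer d (\<lambda>i. c i + real (x i)) \<beta>"
proof -
  have p: "(\<Prod>k<j. real n - (- b - real k)) = pochhammer (b + real n) j" for n j b
    by (induction j) (simp_all add: pochhammer_Suc algebra_simps)
  have "vec_pochhammer d (\<lambda>i. c i + real (x i)) \<beta> = (\<Prod>i<d. pochhammer (c i + real (x i)) (\<beta> i))"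
    unfolding vec_pochhammer_def using assms
    by (intro prod_le_eq_prod_less) (simp add: exponents_lt_def)
  then show ?thesis
    by (simp add: newton_prod_def p)
qed

text \<open>If a diagonal operator has eigenvalues depending only on the total degree, subtracting
  the one at \<open>k\<close> kills the terms of degree \<open>k\<close> and leaves those
  below.\<close>

lemma newton_span_diagonal:
  "(\<lambda>x. \<Sum>\<beta>\<in>exponents_lt d (Suc k). c \<beta> * (\<mu> (\<Sum>i<d. \<beta> i) - \<mu> k) * newton_prod d t \<beta> x)
     \<in> newton_span d t k"
proof (rule newton_span_sum)
  fix \<beta> assume \<beta>: "\<beta> \<in> exponents_lt d (Suc k)"
  show "(\<lambda>x. c \<beta> * (\<mu> (\<Sum>i<d. \<beta> i) - \<mu> k) * newton_prod d t \<beta> x) \<in> newton_span d t k"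
  proof (cases "(\<Sum>i<d. \<beta> i) = k")
    case False
    with \<beta> have "\<beta> \<in> exponents_lt d k" by (auto simp: exponents_lt_def)
    then show ?thesis by (intro newton_span_scale newton_prod_in_span)
  qed simp
qed

section \<open>The kernels \<open>E\<^sub>m\<close> and the downward move\<close>

lemma hahn_E_sym: "hahn_E d \<kappa> m x y = hahn_E d \<kappa> m y x"
  by (simp add: hahn_E_def mult.commute)

text \<open>In each coordinate the two rising factorials of nonpositive integers carry the same sign
  (-1)^g, so their product is nonnegative.\<close>

lemma hahn_E_nonneg:
  assumes "\<forall>j\<le>d. \<kappa> j > -1"
  shows "hahn_E d \<kappa> m x y \<ge> 0"
  unfolding hahn_E_def
proof (intro sum_nonneg divide_nonneg_nonneg[OF _ mult_nonneg_nonneg])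
  fix \<gamma>
  have "pochhammer (- real a) g * pochhammer (- real b) g \<ge> 0" for a b g
    by (simp add: pochhammer_neg_of_nat mult_ac)
  then show "0 \<le> vec_pochhammer d (\<lambda>i. - real (x i)) \<gamma> * vec_pochhammer d (\<lambda>i. - real (y i)) \<gamma>"
    unfolding vec_pochhammer_def prod.distrib[symmetric] by (intro prod_nonneg) auto
  show "0 \<le> vec_pochhammer d (\<lambda>i. \<kappa> i + 1) \<gamma>"
    unfolding vec_pochhammer_def using assms by (intro prod_nonneg pochhammer_nonneg) fastforce
  show "0 \<le> vec_fact d \<gamma>"
    unfolding vec_fact_def by (intro prod_nonneg) auto
qed

text \<open>In the falling factorial basis the moment formula with \<open>c = - x\<close> makes the
  sum diagonal, with an eigenvalue depending only on the degree.\<close>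

lemma downward_newton_span:
  assumes p: "p \<in> newton_span d t (Suc k)"
  shows "(\<lambda>x. (\<Sum>\<gamma>\<in>lattice_simplex d m. vec_pochhammer d (\<lambda>i. - real (x i)) \<gamma> / vec_fact d \<gamma> * p \<gamma>)
     - (-1) ^ m * (if k \<le> m then (real N - real k) gchoose (m - k) else 0) * p x) \<in> simplex_polys d N k"
proof -
  define \<mu> where "\<mu> k = (-1) ^ m * (if k \<le> m then (real N - real k) gchoose (m - k) else 0)" for k
  define t' where "t' = (\<lambda>_::nat. real)"
  obtain c where c: "p = (\<lambda>x. \<Sum>\<beta>\<in>exponents_lt d (Suc k). c \<beta> * newton_prod d t' \<beta> x)"
    using p newton_span_nodes_irrelevant[of d t "Suc k" t'] unfolding newton_span_def by blast
  have basis: "(\<Sum>\<gamma>\<in>lattice_simplex d m. vec_pochhammer d (\<lambda>i. - real (x i)) \<gamma> / vec_fact d \<gamma>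
        * newton_prod d t' \<beta> \<gamma>) = \<mu> (\<Sum>i<d. \<beta> i) * newton_prod d t' \<beta> x"
    if x: "x \<in> lattice_simplex d N" and \<beta>: "\<beta> \<in> exponents_lt d (Suc k)" for x \<beta>
  proof -
    have s: "(\<Sum>i\<le>d. \<beta> i) = (\<Sum>i<d. \<beta> i)"
      using \<beta> by (simp add: lessThan_Suc_atMost[symmetric] exponents_lt_def)
    \<comment> \<open>Membership of \<open>x\<close> in the simplex enters here: it makes the
      eigenvalue independent of \<open>x\<close>.\<close>
    have sx: "(\<Sum>i\<le>d. - real (x i)) = - real N"
      using x by (simp add: lattice_simplex_def sum_negf flip: of_nat_sum)
    let ?b = "\<Sum>i<d. \<beta> i"
    have g: "(-1) ^ ?b * (pochhammer (- real N + real ?b) (m - ?b) / fact (m - ?b)) =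
          (-1) ^ m * ((real N - real ?b) gchoose (m - ?b))" if "?b \<le> m"
    proof -
      have "(-1) ^ ?b * (-1) ^ (m - ?b) = (-1 :: real) ^ m"
        using that by (simp flip: power_add)
      then show ?thesis
        unfolding pochhammer_div_fact_gbinomial mult.assoc[symmetric] by simp
    qed
    have "(\<Sum>\<gamma>\<in>lattice_simplex d m. vec_pochhammer d (\<lambda>i. - real (x i)) \<gamma> / vec_fact d \<gamma>
        * newton_prod d t' \<beta> \<gamma>) = (-1) ^ ?b *
      (\<Sum>\<gamma>\<in>lattice_simplex d m. vec_pochhammer d (\<lambda>i. - real (x i)) \<gamma> / vec_fact d \<gamma>
        * vec_pochhammer d (\<lambda>i. - real (\<gamma> i)) \<beta>)"
      unfolding t'_def newton_prod_falling[OF \<beta>] by (simp add: sum_distrib_left mult_ac)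
    also have "\<dots> = newton_prod d t' \<beta> x * ((-1) ^ ?b *
        (if ?b \<le> m then pochhammer (- real N + real ?b) (m - ?b) / fact (m - ?b) else 0))"
      unfolding sum_lattice_simplex_pochhammer s sx t'_def newton_prod_falling[OF \<beta>]
      by (simp only: mult_ac)
    also have "\<dots> = \<mu> ?b * newton_prod d t' \<beta> x"
      using g by (simp add: \<mu>_def)
    finally show ?thesis .
  qed
  have "(\<Sum>\<gamma>\<in>lattice_simplex d m. vec_pochhammer d (\<lambda>i. - real (x i)) \<gamma> / vec_fact d \<gamma> * p \<gamma>)
     - \<mu> k * p x = (\<Sum>\<beta>\<in>exponents_lt d (Suc k). c \<beta> * (\<mu> (\<Sum>i<d. \<beta> i) - \<mu> k) * newton_prod d t' \<beta> x)"
    if x: "x \<in> lattice_simplex d N" for x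
  proof -
    have "(\<Sum>\<gamma>\<in>lattice_simplex d m. vec_pochhammer d (\<lambda>i. - real (x i)) \<gamma> / vec_fact d \<gamma> * p \<gamma>) =
       (\<Sum>\<beta>\<in>exponents_lt d (Suc k). c \<beta> * (\<Sum>\<gamma>\<in>lattice_simplex d m.
          vec_pochhammer d (\<lambda>i. - real (x i)) \<gamma> / vec_fact d \<gamma> * newton_prod d t' \<beta> \<gamma>))"
      unfolding c sum_distrib_left by (subst sum.swap) (simp add: mult_ac)
    also have "\<dots> = (\<Sum>\<beta>\<in>exponents_lt d (Suc k). c \<beta> * (\<mu> (\<Sum>i<d. \<beta> i) * newton_prod d t' \<beta> x))"
      using basis[OF x] by (intro sum.cong) simp_all
    finally show ?thesis
      by (simp add: c sum_distrib_left sum_subtractf algebra_simps)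
  qed
  then show ?thesis
    by (intro simplex_polysI[OF newton_span_diagonal]) (simp only: \<mu>_def)
qed

section \<open>Hahn kernels\<close>

locale hahn =
  fixes d N :: nat and \<kappa> :: "nat \<Rightarrow> real"
  assumes kappa: "\<forall>j\<le>d. \<kappa> j > -1"
begin

abbreviation "\<Delta> \<equiv> lattice_simplex d N"
abbreviation "ip \<equiv> hahn_inner d \<kappa> N"
abbreviation "Pol \<equiv> simplex_polys d N"
abbreviation "V \<equiv> hahn_space d \<kappa> N"

definition ksum :: real where
  "ksum = (\<Sum>i\<le>d. \<kappa> i) + real d + 1"

lemma ksum_eq: "ksum = (\<Sum>i\<le>d. \<kappa> i + 1)"
  by (simp add: ksum_def sum.distrib)

lemma ksum_pos: "ksum > 0"
  unfolding ksum_eq using kappa by (intro sum_pos) (auto simp: add.commute[of _ 1] minus_less_iff)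

definition weight :: "(nat \<Rightarrow> nat) \<Rightarrow> real" where
  "weight \<alpha> = fact N / pochhammer ksum N * (vec_pochhammer d (\<lambda>i. \<kappa> i + 1) \<alpha> / vec_fact d \<alpha>)"

lemma vec_pochhammer_kappa_pos: "vec_pochhammer d (\<lambda>i. \<kappa> i + 1) \<alpha> > 0"
  unfolding vec_pochhammer_def using kappa by (intro prod_pos pochhammer_pos) fastforce

lemma vec_fact_pos: "vec_fact d \<alpha> > 0"
  unfolding vec_fact_def by (intro prod_pos) auto

lemma vec_pochhammer_kappa_nonzero: "vec_pochhammer d (\<lambda>i. \<kappa> i + 1) \<alpha> \<noteq> 0"
  and vec_fact_nonzero: "vec_fact d \<alpha> \<noteq> 0"
  using vec_pochhammer_kappa_pos[of \<alpha>] vec_fact_pos[of \<alpha>] by auto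

lemma weight_pos: "weight \<alpha> > 0"
  unfolding weight_def
  by (intro mult_pos_pos divide_pos_pos pochhammer_pos ksum_pos vec_pochhammer_kappa_pos vec_fact_pos) auto

lemma ip_altdef: "ip f g = (\<Sum>\<alpha>\<in>\<Delta>. weight \<alpha> * f \<alpha> * g \<alpha>)"
  unfolding hahn_inner_def weight_def ksum_def sum_distrib_left
  by (intro sum.cong) (simp_all add: mult_ac)

lemma ip_commute: "ip f g = ip g f"
  by (simp add: ip_altdef mult_ac)

lemma ip_cong: "(\<And>x. x \<in> \<Delta> \<Longrightarrow> f x = f' x) \<Longrightarrow> (\<And>x. x \<in> \<Delta> \<Longrightarrow> g x = g' x) \<Longrightarrow> ip f g = ip f' g'"
  unfolding ip_altdef by (intro sum.cong) auto

lemma ip_add_left: "ip (\<lambda>x. f x + g x) h = ip f h + ip g h"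
  by (simp add: ip_altdef algebra_simps sum.distrib)

lemma ip_diff_left: "ip (\<lambda>x. f x - g x) h = ip f h - ip g h"
  by (simp add: ip_altdef algebra_simps sum_subtractf)

lemma ip_scale_left: "ip (\<lambda>x. b * f x) h = b * ip f h"
  by (simp add: ip_altdef sum_distrib_left mult_ac)

lemma ip_sum_left: "ip (\<lambda>x. \<Sum>s\<in>S. c s * f s x) h = (\<Sum>s\<in>S. c s * ip (f s) h)"
  unfolding ip_altdef sum_distrib_left sum_distrib_right
  by (subst sum.swap) (simp add: mult_ac)

lemma ip_self_eq_0:
  assumes "ip f f = 0" "x \<in> \<Delta>"
  shows "f x = 0"
proof -
  have nonneg: "weight \<alpha> * f \<alpha> * f \<alpha> \<ge> 0" for \<alpha>
    using weight_pos[of \<alpha>] by (simp add: mult.assoc)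
  have "\<forall>\<alpha>\<in>\<Delta>. weight \<alpha> * f \<alpha> * f \<alpha> = 0"
    using assms(1) nonneg unfolding ip_altdef by (simp add: sum_nonneg_eq_0_iff)
  then show ?thesis
    using assms(2) weight_pos[of x] by auto
qed

section \<open>Orthogonal decomposition into Hahn spaces\<close>

text \<open>Gram-Schmidt for a possibly dependent family: the new member is first made orthogonal to
  the old ones, and the residual of \<open>f\<close> is then corrected along it.\<close>

lemma orthogonal_projection:
  assumes "finite S"
  shows "\<exists>c. \<forall>s\<in>S. ip (\<lambda>x. f x - (\<Sum>s\<in>S. c s * g s x)) (g s) = 0"
  using assms
proof (induction S arbitrary: f rule: finite_induct)
  case empty
  then show ?case by simp
next
  case (insert t S)
  obtain b where b: "\<forall>s\<in>S. ip (\<lambda>x. g t x - (\<Sum>s\<in>S. b s * g s x)) (g s) = 0"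
    using insert.IH by blast
  obtain c where c: "\<forall>s\<in>S. ip (\<lambda>x. f x - (\<Sum>s\<in>S. c s * g s x)) (g s) = 0"
    using insert.IH by blast
  define h where "h = (\<lambda>x. g t x - (\<Sum>s\<in>S. b s * g s x))"
  define e where "e = (\<lambda>x. f x - (\<Sum>s\<in>S. c s * g s x))"
  \<comment> \<open>If \<open>ip h h = 0\<close>, division yields \<open>l = 0\<close>; this is
    harmless, since \<open>h\<close> then vanishes on the simplex.\<close>
  define l where "l = ip e h / ip h h"
  define c' where "c' s = (if s = t then l else c s - l * b s)" for s
  have eq: "f x - (\<Sum>s\<in>insert t S. c' s * g s x) = e x - l * h x" for x
  proof -
    have "(\<Sum>s\<in>S. c' s * g s x) = (\<Sum>s\<in>S. (c s - l * b s) * g s x)"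
      using insert.hyps by (intro sum.cong) (auto simp: c'_def)
    then show ?thesis
      using insert.hyps
      by (simp add: c'_def e_def h_def sum_subtractf sum_distrib_left algebra_simps)
  qed
  have oS: "ip e (g s) = 0" "ip h (g s) = 0" if "s \<in> S" for s
    using b c that by (auto simp: h_def e_def)
  have gt: "g t = (\<lambda>x. h x + (\<Sum>s\<in>S. b s * g s x))"
    by (simp add: h_def)
  \<comment> \<open>\<open>g t\<close> and \<open>h\<close> differ by a combination of the old
    \<open>g s\<close>.\<close>
  have t: "ip u (g t) = ip u h" if "\<And>s. s \<in> S \<Longrightarrow> ip u (g s) = 0" for u
    using that unfolding ip_commute[of u] by (subst gt) (simp add: ip_add_left ip_sum_left)
  have "ip e h - l * ip h h = 0"
  proof (cases "ip h h = 0")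
    case True
    then have "ip e h = ip e (\<lambda>_. 0)"
      using ip_self_eq_0 by (intro ip_cong) auto
    with True show ?thesis by (simp add: ip_altdef)
  qed (simp add: l_def)
  then have "\<forall>s\<in>insert t S. ip (\<lambda>x. e x - l * h x) (g s) = 0"
    using oS t[of e] t[of h] by (auto simp: ip_diff_left ip_scale_left)
  then show ?case
    unfolding eq[symmetric] by blast
qed

text \<open>The conditions strengthen with \<open>m\<close>, so the one at \<open>m = n - 1\<close>
  suffices. For \<open>n = 0\<close> both sides impose nothing, as members of \<open>Pol 0\<close>
  vanish on the simplex.\<close>

lemma hahn_space_eq: "V n = {f \<in> Pol (Suc n). \<forall>g\<in>Pol n. ip f g = 0}"
proof -
  have "(\<forall>m<n. \<forall>g\<in>Pol (Suc m). ip f g = 0) \<longleftrightarrow> (\<forall>g\<in>Pol n. ip f g = 0)" for f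
  proof (cases n)
    case 0
    have "ip f g = 0" if "g \<in> Pol 0" for g
      using simplex_polys_zero[OF that] by (simp add: ip_altdef)
    then show ?thesis using 0 by auto
  next
    case (Suc k)
    then show ?thesis
      using simplex_polys_mono[of _ d N _ n] by (metis Suc_leI lessI)
  qed
  then show ?thesis
    unfolding hahn_space_def hahn_polys_eq by auto
qed

lemma hahn_space_cong:
  assumes "f \<in> V n" "\<And>x. x \<in> \<Delta> \<Longrightarrow> f x = g x"
  shows "g \<in> V n"
proof -
  have "ip f h = ip g h" for h
    using assms(2) by (intro ip_cong) auto
  then show ?thesis
    using assms(1) simplex_polys_cong[OF _ assms(2)] unfolding hahn_space_eq by auto
qed

lemma hahn_spaces_orthogonal:
  assumes "f \<in> V m" "g \<in> V n" "m \<noteq> n"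
  shows "ip f g = 0"
proof -
  have *: "ip f g = 0" if "f \<in> V m" "g \<in> V n" "m < n" for f g m n
    using that simplex_polys_mono[of f d N "Suc m" n]
    unfolding hahn_space_eq by (auto simp: ip_commute[of f])
  show ?thesis
    using assms *[of f m g n] *[of g n f m] by (cases "m < n") (auto simp: ip_commute[of f])
qed

lemma orthogonal_decomposition_step:
  assumes "f \<in> Pol (Suc n)"
  obtains p where "p \<in> Pol n" "(\<lambda>x. f x - p x) \<in> V n"
proof -
  define t where "t = (\<lambda>(_::nat) (_::nat). 0 :: real)"
  obtain c where c: "\<forall>\<gamma>\<in>exponents_lt d n.
      ip (\<lambda>x. f x - (\<Sum>\<gamma>\<in>exponents_lt d n. c \<gamma> * newton_prod d t \<gamma> x)) (newton_prod d t \<gamma>) = 0"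
    using orthogonal_projection[OF finite_exponents_lt] by blast
  define p where "p = (\<lambda>x. \<Sum>\<gamma>\<in>exponents_lt d n. c \<gamma> * newton_prod d t \<gamma> x)"
  have "p \<in> newton_span d t n"
    unfolding p_def by (intro newton_span_sum newton_span_scale newton_prod_in_span)
  then have p: "p \<in> Pol n" by (rule simplex_polysI) simp
  have "ip (\<lambda>x. f x - p x) g = 0" if g: "g \<in> Pol n" for g
  proof -
    obtain b where b: "\<And>x. x \<in> \<Delta> \<Longrightarrow> g x = (\<Sum>\<gamma>\<in>exponents_lt d n. b \<gamma> * newton_prod d t \<gamma> x)"
      using simplex_polysE[OF g] by blast
    have "ip (\<lambda>x. f x - p x) g = ip g (\<lambda>x. f x - p x)" by (rule ip_commute)
    also have "\<dots> = ip (\<lambda>x. \<Sum>\<gamma>\<in>exponents_lt d n. b \<gamma> * newton_prod d t \<gamma> x) (\<lambda>x. f x - p x)"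
      using b by (intro ip_cong) auto
    also have "\<dots> = 0"
      unfolding ip_sum_left using c by (simp add: p_def ip_commute[of "newton_prod d t _"])
    finally show ?thesis .
  qed
  moreover have "(\<lambda>x. f x - p x) \<in> Pol (Suc n)"
    using assms simplex_polys_mono[OF p, of "Suc n"] by (intro simplex_polys_diff) auto
  ultimately have "(\<lambda>x. f x - p x) \<in> V n" by (simp add: hahn_space_eq)
  with p that show ?thesis by blast
qed

lemma orthogonal_decomposition:
  "f \<in> Pol n \<Longrightarrow> \<exists>q. (\<forall>k<n. q k \<in> V k) \<and> (\<forall>x\<in>\<Delta>. f x = (\<Sum>k<n. q k x))"
proof (induction n arbitrary: f)
  case 0
  then show ?case using simplex_polys_zero by auto
next
  case (Suc n)
  obtain p where p: "p \<in> Pol n" "(\<lambda>x. f x - p x) \<in> V n"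
    using orthogonal_decomposition_step[OF Suc.prems] .
  obtain q where q: "\<forall>k<n. q k \<in> V k" "\<forall>x\<in>\<Delta>. p x = (\<Sum>k<n. q k x)"
    using Suc.IH[OF p(1)] by blast
  define q' where "q' = q(n := (\<lambda>x. f x - p x))"
  have "\<forall>k<Suc n. q' k \<in> V k"
    using q(1) p(2) by (auto simp: q'_def less_Suc_eq)
  moreover have "f x = (\<Sum>k<Suc n. q' k x)" if "x \<in> \<Delta>" for x
    using q(2) that by (simp add: q'_def)
  ultimately show ?case by blast
qed

section \<open>Action of the kernels \<open>E\<^sub>m\<close> on the Hahn spaces\<close>

definition E_op :: "nat \<Rightarrow> ((nat \<Rightarrow> nat) \<Rightarrow> real) \<Rightarrow> (nat \<Rightarrow> nat) \<Rightarrow> real" where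
  "E_op m f x = ip (hahn_E d \<kappa> m x) f"

lemma E_op_self_adjoint: "ip (E_op m f) g = ip f (E_op m g)"
  unfolding E_op_def ip_altdef sum_distrib_left sum_distrib_right
  by (subst sum.swap) (simp add: hahn_E_sym mult_ac)

lemma E_op_cong: "(\<And>x. x \<in> \<Delta> \<Longrightarrow> f x = g x) \<Longrightarrow> E_op m f = E_op m g"
  unfolding E_op_def by (intro ext ip_cong) auto

text \<open>Summing over \<open>y\<close> first performs the upward move. The rising product is
  absorbed into the weight, shifting \<kappa> to \<kappa> + \<beta>; the moment formula applies, and
  the same identity at \<open>\<gamma>\<close> restores the product. Only the downward sum
  remains.\<close>

lemma E_op_rising:
  fixes m :: nat
  defines "t \<equiv> \<lambda>i k. - (\<kappa> i + 1 + real k)"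
  assumes \<beta>: "\<beta> \<in> exponents_lt d n" and m: "m \<le> N"
  shows "E_op m (newton_prod d t \<beta>) x =
    fact N / pochhammer ksum N * (-1) ^ m *
      (pochhammer (ksum + real m + real (\<Sum>i<d. \<beta> i)) (N - m) / fact (N - m)) *
      (\<Sum>\<gamma>\<in>lattice_simplex d m. vec_pochhammer d (\<lambda>i. - real (x i)) \<gamma> / vec_fact d \<gamma> * newton_prod d t \<beta> \<gamma>)"
proof -
  let ?\<kappa> = "\<lambda>i. \<kappa> i + 1"
  let ?b = "\<Sum>i<d. \<beta> i"
  let ?vp = "vec_pochhammer d"
  have split: "?vp ?\<kappa> y * newton_prod d t \<beta> y = ?vp ?\<kappa> \<beta> * ?vp (\<lambda>i. ?\<kappa> i + real (\<beta> i)) y" for y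
  proof -
    have "pochhammer c j * pochhammer (c + real j) b = pochhammer c b * pochhammer (c + real b) j"
      for c :: real and j b
      by (simp add: pochhammer_product'[symmetric] add.commute)
    then show ?thesis
      unfolding t_def newton_prod_rising[OF \<beta>] vec_pochhammer_def prod.distrib[symmetric] by simp
  qed
  have sb: "(\<Sum>i\<le>d. ?\<kappa> i + real (\<beta> i)) = ksum + real ?b"
    using \<beta> unfolding ksum_eq sum.distrib
    by (simp add: lessThan_Suc_atMost[symmetric] exponents_lt_def)
  have inner: "(\<Sum>y\<in>\<Delta>. ?vp ?\<kappa> y / vec_fact d y * ?vp (\<lambda>i. - real (y i)) \<gamma> * newton_prod d t \<beta> y) =
     (-1) ^ m * (?vp ?\<kappa> \<gamma> * newton_prod d t \<beta> \<gamma>) *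
      (pochhammer (ksum + real m + real ?b) (N - m) / fact (N - m))"
    if "\<gamma> \<in> lattice_simplex d m" for \<gamma>
  proof -
    have s: "(\<Sum>i\<le>d. \<gamma> i) = m" using that by (simp add: lattice_simplex_def)
    have "(\<Sum>y\<in>\<Delta>. ?vp ?\<kappa> y / vec_fact d y * ?vp (\<lambda>i. - real (y i)) \<gamma> * newton_prod d t \<beta> y) =
      (\<Sum>y\<in>\<Delta>. (?vp ?\<kappa> y * newton_prod d t \<beta> y) / vec_fact d y * ?vp (\<lambda>i. - real (y i)) \<gamma>)"
      by (intro sum.cong) (simp_all add: mult_ac)
    also have "\<dots> = ?vp ?\<kappa> \<beta> * (\<Sum>y\<in>\<Delta>. ?vp (\<lambda>i. ?\<kappa> i + real (\<beta> i)) y / vec_fact d y * ?vp (\<lambda>i. - real (y i)) \<gamma>)"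
      unfolding split by (simp add: sum_distrib_left mult_ac)
    also have "\<dots> = (-1) ^ m * (?vp ?\<kappa> \<beta> * ?vp (\<lambda>i. ?\<kappa> i + real (\<beta> i)) \<gamma>) *
        (pochhammer (ksum + real m + real ?b) (N - m) / fact (N - m))"
      unfolding sum_lattice_simplex_pochhammer s sb using m by (simp add: add_ac)
    finally show ?thesis unfolding split[symmetric] .
  qed
  have "E_op m (newton_prod d t \<beta>) x = fact N / pochhammer ksum N *
     (\<Sum>y\<in>\<Delta>. \<Sum>\<gamma>\<in>lattice_simplex d m. ?vp (\<lambda>i. - real (x i)) \<gamma> / (?vp ?\<kappa> \<gamma> * vec_fact d \<gamma>) *
        (?vp ?\<kappa> y / vec_fact d y * ?vp (\<lambda>i. - real (y i)) \<gamma> * newton_prod d t \<beta> y))"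
    unfolding E_op_def ip_altdef weight_def hahn_E_def sum_distrib_left sum_distrib_right
    by (simp add: mult_ac)
  also have "\<dots> = fact N / pochhammer ksum N *
     (\<Sum>\<gamma>\<in>lattice_simplex d m. ?vp (\<lambda>i. - real (x i)) \<gamma> / (?vp ?\<kappa> \<gamma> * vec_fact d \<gamma>) *
      ((-1) ^ m * (?vp ?\<kappa> \<gamma> * newton_prod d t \<beta> \<gamma>) *
      (pochhammer (ksum + real m + real ?b) (N - m) / fact (N - m))))"
    unfolding sum.swap[of _ "lattice_simplex d m"] sum_distrib_left[symmetric]
    by (intro arg_cong[where f = "(*) (fact N / pochhammer ksum N)"] sum.cong refl) (simp only: inner)
  also have "\<dots> = fact N / pochhammer ksum N *
     (\<Sum>\<gamma>\<in>lattice_simplex d m. ((-1) ^ m * (pochhammer (ksum + real m + real ?b) (N - m) / fact (N - m))) *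
       (?vp (\<lambda>i. - real (x i)) \<gamma> / vec_fact d \<gamma> * newton_prod d t \<beta> \<gamma>))"
    by (intro arg_cong[where f = "(*) (fact N / pochhammer ksum N)"] sum.cong refl,
        simp add: vec_pochhammer_kappa_nonzero, simp add: mult_ac)
  finally show ?thesis
    unfolding sum_distrib_left[symmetric] by (simp only: mult.assoc)
qed

text \<open>The upward move, diagonal in the rising basis, sends \<open>p\<close> to
  \<open>q\<close>, and the downward move \<open>D\<close> acts on \<open>q\<close>. Modulo lower
  degree these multiply by \<open>\<mu> k\<close> and \<open>\<nu>\<close>.\<close>

lemma E_op_leading:
  assumes f: "f \<in> Pol (Suc k)" and m: "m \<le> N"
  shows "(\<lambda>x. E_op m f x - hahn_eigenvalue ksum N m k * f x) \<in> Pol k"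
proof -
  define t where "t = (\<lambda>i k. - (\<kappa> i + 1 + real k))"
  define \<mu> where "\<mu> b = fact N / pochhammer ksum N * (-1) ^ m *
      (pochhammer (ksum + real m + real b) (N - m) / fact (N - m))" for b :: nat
  define \<nu> where "\<nu> = (-1) ^ m * (if k \<le> m then (real N - real k) gchoose (m - k) else 0)"
  define D where "D p x = (\<Sum>\<gamma>\<in>lattice_simplex d m. vec_pochhammer d (\<lambda>i. - real (x i)) \<gamma> / vec_fact d \<gamma> * p \<gamma>)" for p x
  obtain c where c: "\<And>x. x \<in> \<Delta> \<Longrightarrow> f x = (\<Sum>\<beta>\<in>exponents_lt d (Suc k). c \<beta> * newton_prod d t \<beta> x)"
    using simplex_polysE[OF f] by blast
  define p where "p = (\<lambda>x. \<Sum>\<beta>\<in>exponents_lt d (Suc k). c \<beta> * newton_prod d t \<beta> x)"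
  define q where "q = (\<lambda>x. \<Sum>\<beta>\<in>exponents_lt d (Suc k). c \<beta> * \<mu> (\<Sum>i<d. \<beta> i) * newton_prod d t \<beta> x)"
  \<comment> \<open>Each of the two scalars carries a sign (-1)^m; the signs cancel.\<close>
  have ev: "hahn_eigenvalue ksum N m k = \<nu> * \<mu> k"
    by (simp add: hahn_eigenvalue_def \<nu>_def \<mu>_def)
  have Ef: "E_op m f x = D q x" for x
  proof -
    have "E_op m f x = E_op m p x"
      using c by (subst E_op_cong[of f p]) (simp_all add: p_def)
    also have "\<dots> = (\<Sum>\<beta>\<in>exponents_lt d (Suc k). c \<beta> * E_op m (newton_prod d t \<beta>) x)"
      unfolding E_op_def p_def ip_commute[of "hahn_E d \<kappa> m x"] ip_sum_left ..
    also have "\<dots> = (\<Sum>\<beta>\<in>exponents_lt d (Suc k). c \<beta> * (\<mu> (\<Sum>i<d. \<beta> i) * D (newton_prod d t \<beta>) x))"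
      unfolding t_def \<mu>_def D_def by (intro sum.cong refl) (simp only: E_op_rising[OF _ m])
    also have "\<dots> = D q x"
      unfolding D_def q_def sum_distrib_left by (subst sum.swap) (simp add: mult_ac)
    finally show ?thesis .
  qed
  have "q \<in> newton_span d t (Suc k)"
    unfolding q_def by (intro newton_span_sum newton_span_scale newton_prod_in_span)
  then have "(\<lambda>x. D q x - \<nu> * q x) \<in> Pol k"
    unfolding D_def \<nu>_def by (rule downward_newton_span)
  moreover have "(\<lambda>x. q x - \<mu> k * p x) \<in> Pol k"
    by (rule simplex_polysI[OF newton_span_diagonal[where d = d and k = k and c = c and \<mu> = \<mu> and t = t]])
       (simp add: q_def p_def sum_distrib_left sum_subtractf algebra_simps)
  ultimately have "(\<lambda>x. (D q x - \<nu> * q x) + \<nu> * (q x - \<mu> k * p x)) \<in> Pol k"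
    by (intro simplex_polys_add simplex_polys_scale)
  then show ?thesis
    by (rule simplex_polys_cong) (simp add: Ef ev c p_def algebra_simps)
qed

lemma E_op_polys:
  assumes f: "f \<in> Pol n" and m: "m \<le> N"
  shows "E_op m f \<in> Pol n"
proof (cases n)
  case 0
  have "E_op m f = (\<lambda>_. 0)"
    using f 0 by (auto simp: E_op_def ip_altdef simplex_polys_zero)
  then show ?thesis by (auto intro: simplex_polysI[OF newton_span_zero])
next
  case (Suc k)
  have "(\<lambda>x. (E_op m f x - hahn_eigenvalue ksum N m k * f x) + hahn_eigenvalue ksum N m k * f x) \<in> Pol (Suc k)"
    using f Suc m
    by (intro simplex_polys_add simplex_polys_scale simplex_polys_mono[OF E_op_leading]) auto
  then show ?thesis using Suc by simp
qed

text \<open>The defect \<open>h\<close> lies in \<open>Pol k\<close>. It is also orthogonal to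
  \<open>Pol k\<close>, since the operator is self-adjoint and preserves \<open>Pol k\<close>. So
  \<open>h\<close> is orthogonal to itself.\<close>

lemma E_op_eigen:
  assumes f: "f \<in> V k" and m: "m \<le> N" and x: "x \<in> \<Delta>"
  shows "E_op m f x = hahn_eigenvalue ksum N m k * f x"
proof -
  define h where "h = (\<lambda>x. E_op m f x - hahn_eigenvalue ksum N m k * f x)"
  have h: "h \<in> Pol k"
    unfolding h_def using f m by (intro E_op_leading) (auto simp: hahn_space_eq)
  have "ip h g = 0" if "g \<in> Pol k" for g
    using f that E_op_polys[OF that m]
    unfolding h_def by (simp add: ip_diff_left ip_scale_left E_op_self_adjoint hahn_space_eq)
  then have "h x = 0"
    using ip_self_eq_0[OF _ x] h by blast
  then show ?thesis by (simp add: h_def)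
qed

text \<open>For |\<gamma>| = N both rising factorials are point indicators, so only
  \<open>\<gamma> = x = y\<close> contributes.\<close>

lemma hahn_E_top:
  assumes "x \<in> \<Delta>" "y \<in> \<Delta>"
  shows "hahn_E d \<kappa> N x y = (if x = y then fact N / pochhammer ksum N / weight y else 0)"
proof -
  have "pochhammer ksum N > 0" by (intro pochhammer_pos ksum_pos)
  moreover have "hahn_E d \<kappa> N x y = (\<Sum>\<gamma>\<in>\<Delta>. if \<gamma> = x then
      if x = y then vec_fact d y / vec_pochhammer d (\<lambda>i. \<kappa> i + 1) y else 0 else 0)"
    unfolding hahn_E_def using assms
    by (intro sum.cong refl) (auto simp: pochhammer_neg_simplex vec_fact_nonzero)
  ultimately show ?thesis
    using assms by (simp add: weight_def)
qed

section \<open>Reproducing kernels as components of point evaluations\<close>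

text \<open>The representer of evaluation at \<open>y\<close> among all functions on the
  simplex.\<close>

definition dirac :: "(nat \<Rightarrow> nat) \<Rightarrow> (nat \<Rightarrow> nat) \<Rightarrow> real" where
  "dirac y x = (if x = y then 1 / weight y else 0)"

lemma ip_dirac: "y \<in> \<Delta> \<Longrightarrow> ip (dirac y) f = f y"
  using weight_pos[of y]
  by (simp add: ip_altdef dirac_def if_distrib[of "\<lambda>c. _ * c * _"] if_distrib[of "\<lambda>c. c * _"] cong: if_cong)

lemma dirac_in_simplex_polys:
  assumes "y \<in> \<Delta>"
  shows "dirac y \<in> Pol (Suc N)"
proof -
  have "(\<lambda>x. 1 / ((-1) ^ N * vec_fact d y * weight y) * vec_pochhammer d (\<lambda>i. - real (x i)) y) \<in> Pol (Suc N)"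
    by (intro simplex_polys_scale vec_pochhammer_neg_in_simplex_polys assms)
  then show ?thesis
    by (rule simplex_polys_cong)
       (use assms vec_fact_pos[of y] in \<open>simp add: pochhammer_neg_simplex dirac_def\<close>)
qed

text \<open>The components of \<open>dirac y\<close> in the Hahn spaces; the \<open>n\<close>-th one
  is the candidate for the \<open>n\<close>-th reproducing kernel at \<open>y\<close>.\<close>

definition dirac_part :: "(nat \<Rightarrow> nat) \<Rightarrow> nat \<Rightarrow> (nat \<Rightarrow> nat) \<Rightarrow> real" where
  "dirac_part y = (SOME q. (\<forall>k<Suc N. q k \<in> V k) \<and> (\<forall>x\<in>\<Delta>. dirac y x = (\<Sum>k<Suc N. q k x)))"

lemma dirac_part:
  assumes "y \<in> \<Delta>"
  shows "n \<le> N \<Longrightarrow> dirac_part y n \<in> V n"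
    and "x \<in> \<Delta> \<Longrightarrow> dirac y x = (\<Sum>n\<le>N. dirac_part y n x)"
proof -
  have "(\<forall>k<Suc N. dirac_part y k \<in> V k) \<and> (\<forall>x\<in>\<Delta>. dirac y x = (\<Sum>k<Suc N. dirac_part y k x))"
    unfolding dirac_part_def
    by (rule someI_ex[OF orthogonal_decomposition[OF dirac_in_simplex_polys[OF assms]]])
  then show "n \<le> N \<Longrightarrow> dirac_part y n \<in> V n"
    and "x \<in> \<Delta> \<Longrightarrow> dirac y x = (\<Sum>n\<le>N. dirac_part y n x)"
    by (auto simp: lessThan_Suc_atMost)
qed

lemma dirac_part_reproducing:
  assumes y: "y \<in> \<Delta>" and n: "n \<le> N" and Q: "Q \<in> V n"
  shows "ip (dirac_part y n) Q = Q y"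
proof -
  have "Q y = ip (\<lambda>x. \<Sum>k\<le>N. 1 * dirac_part y k x) Q"
    using y by (subst ip_dirac[symmetric], simp) (intro ip_cong, auto simp: dirac_part)
  also have "\<dots> = (\<Sum>k\<le>N. if k = n then ip (dirac_part y n) Q else 0)"
    unfolding ip_sum_left
    by (intro sum.cong refl) (use y Q in \<open>auto intro: hahn_spaces_orthogonal dirac_part\<close>)
  finally show ?thesis using n by simp
qed

lemma dirac_part_sym:
  assumes "x \<in> \<Delta>" "y \<in> \<Delta>" "n \<le> N"
  shows "dirac_part x n y = dirac_part y n x"
  using assms dirac_part_reproducing dirac_part(1) ip_commute by metis

lemma is_hahn_kernel_dirac_part:
  assumes n: "n \<le> N"
  shows "is_hahn_kernel d \<kappa> N n (\<lambda>x. dirac_part x n)"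
  unfolding is_hahn_kernel_def
proof (intro conjI ballI)
  fix y assume y: "y \<in> \<Delta>"
  show "dirac_part y n \<in> V n"
    using y n by (rule dirac_part(1))
  then show "(\<lambda>x. dirac_part x n y) \<in> V n"
    by (rule hahn_space_cong) (use y n in \<open>simp add: dirac_part_sym\<close>)
next
  fix x Q assume "x \<in> \<Delta>" "Q \<in> V n"
  then show "ip (dirac_part x n) Q = Q x"
    using n by (intro dirac_part_reproducing)
qed

text \<open>Uniqueness: the inner product of the chosen kernel at \<open>x\<close> with
  \<open>dirac_part y n\<close> is evaluated by the reproducing property of either factor.\<close>

lemma hahn_kernel_eq:
  assumes x: "x \<in> \<Delta>" and y: "y \<in> \<Delta>" and n: "n \<le> N"
  shows "hahn_kernel d \<kappa> N n x y = dirac_part y n x"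
proof -
  have K: "is_hahn_kernel d \<kappa> N n (hahn_kernel d \<kappa> N n)"
    unfolding hahn_kernel_def by (rule someI[of "is_hahn_kernel d \<kappa> N n", OF is_hahn_kernel_dirac_part[OF n]])
  then have "hahn_kernel d \<kappa> N n x \<in> V n"
    using x by (auto simp: is_hahn_kernel_def)
  then have "hahn_kernel d \<kappa> N n x y = ip (hahn_kernel d \<kappa> N n x) (dirac_part y n)"
    using dirac_part_reproducing[OF y n] by (simp add: ip_commute[of "hahn_kernel d \<kappa> N n x"])
  also have "\<dots> = dirac_part y n x"
    using K x dirac_part(1)[OF y n] by (simp add: is_hahn_kernel_def)
  finally show ?thesis .
qed

section \<open>Expansion of the Poisson kernel\<close>

text \<open>The kernel is recovered by applying its operator to \<open>dirac y\<close>, whose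
  components are eigenfunctions.\<close>

lemma hahn_E_spectral:
  assumes x: "x \<in> \<Delta>" and y: "y \<in> \<Delta>" and m: "m \<le> N"
  shows "hahn_E d \<kappa> m x y = (\<Sum>n\<le>N. hahn_eigenvalue ksum N m n * hahn_kernel d \<kappa> N n x y)"
proof -
  have "hahn_E d \<kappa> m x y = E_op m (dirac y) x"
    unfolding E_op_def using ip_dirac[OF y] by (simp add: ip_commute[of "hahn_E d \<kappa> m x"])
  also have "E_op m (dirac y) = E_op m (\<lambda>x. \<Sum>n\<le>N. 1 * dirac_part y n x)"
    by (intro E_op_cong) (simp add: dirac_part(2)[OF y])
  also have "\<dots> x = (\<Sum>n\<le>N. E_op m (dirac_part y n) x)"
    unfolding E_op_def ip_commute[of "hahn_E d \<kappa> m x"] ip_sum_left by simp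
  also have "\<dots> = (\<Sum>n\<le>N. hahn_eigenvalue ksum N m n * hahn_kernel d \<kappa> N n x y)"
    by (intro sum.cong refl) (use x y m in \<open>simp add: E_op_eigen dirac_part(1) hahn_kernel_eq\<close>)
  finally show ?thesis .
qed

text \<open>Each \<open>r ^ n\<close> is replaced by its expression through the eigenvalues;
  exchanging the sums then produces the spectral expansions of the \<open>E\<^sub>m\<close>.\<close>

lemma hahn_poisson_eq_sum_E:
  assumes x: "x \<in> \<Delta>" and y: "y \<in> \<Delta>"
  shows "hahn_poisson d \<kappa> N r x y = (\<Sum>m\<le>N. poisson_weight ksum N m r * hahn_E d \<kappa> m x y)"
proof -
  have "hahn_poisson d \<kappa> N r x y = (\<Sum>n\<le>N. hahn_kernel d \<kappa> N n x y *
     (\<Sum>m\<le>N. poisson_weight ksum N m r * hahn_eigenvalue ksum N m n))"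
    unfolding hahn_poisson_def
    by (intro sum.cong refl) (simp add: sum_poisson_weight_eigenvalue ksum_pos)
  also have "\<dots> = (\<Sum>m\<le>N. poisson_weight ksum N m r *
     (\<Sum>n\<le>N. hahn_eigenvalue ksum N m n * hahn_kernel d \<kappa> N n x y))"
    unfolding sum_distrib_left by (subst sum.swap) (simp add: mult_ac)
  finally show ?thesis
    using assms by (simp add: hahn_E_spectral)
qed

lemma hahn_poisson_nonneg:
  assumes "x \<in> \<Delta>" "y \<in> \<Delta>" "0 \<le> r" "r \<le> 1"
  shows "hahn_poisson d \<kappa> N r x y \<ge> 0"
  unfolding hahn_poisson_eq_sum_E[OF assms(1,2)] using assms ksum_pos kappa
  by (intro sum_nonneg mult_nonneg_nonneg poisson_weight_nonneg hahn_E_nonneg) auto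

text \<open>At \<open>r = 1\<close> the components of \<open>dirac y\<close> add up to
  \<open>dirac y\<close> itself, and \<open>E\<^sub>N\<close> is a constant multiple of it.\<close>

lemma hahn_poisson_1:
  assumes x: "x \<in> \<Delta>" and y: "y \<in> \<Delta>"
  shows "hahn_poisson d \<kappa> N 1 x y = pochhammer ksum N / fact N * hahn_E d \<kappa> N x y"
proof -
  have "hahn_poisson d \<kappa> N 1 x y = dirac y x"
    using x y by (simp add: hahn_poisson_def hahn_kernel_eq dirac_part(2))
  also have "\<dots> = pochhammer ksum N / fact N * hahn_E d \<kappa> N x y"
    using pochhammer_pos[OF ksum_pos, of N] by (simp add: hahn_E_top x y dirac_def)
  finally show ?thesis .
qed

end

theorem theorem4p6:
  fixes d N :: nat and \<kappa> :: "nat \<Rightarrow> real"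
  assumes "d \<ge> 1" and "\<forall>j\<le>d. \<kappa> j > -1" and "N \<ge> 1"
  shows "(\<forall>x\<in>lattice_simplex d N. \<forall>y\<in>lattice_simplex d N. \<forall>r::real.
            0 \<le> r \<and> r \<le> 1 \<longrightarrow> hahn_poisson d \<kappa> N r x y \<ge> 0) \<and>
         (\<forall>x\<in>lattice_simplex d N. \<forall>y\<in>lattice_simplex d N.
            hahn_poisson d \<kappa> N 1 x y =
              pochhammer ((\<Sum>i\<le>d. \<kappa> i) + real d + 1) N / fact N * hahn_E d \<kappa> N x y)"
proof -
  interpret hahn d N \<kappa>
    using assms by unfold_locales
  show ?thesis
    using hahn_poisson_nonneg hahn_poisson_1 unfolding ksum_def by blast
qed

end
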